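(* Let $\{\widetilde{\mathcal C}_k\}_{k\in K}=\{(\{\widetilde{\mathfrak B}_j\}_{j\in J};\tilde f_k)\}_{k\in K}$ be a collection of partial probability theories on one common (finite) partial Boolean algebra $\{\widetilde{\mathfrak B}_j\}_{j\in J}$, such that $\{\tilde f_k\}_{k\in K}$ is complete with respect to $\{\widetilde{\mathfrak B}_j\}_{j\in J}$. Let $\widetilde{\mathcal G}=\{\widetilde A_1,\dots,\widetilde A_n\}$ be a set of generators of $\{\widetilde{\mathfrak B}_j\}_{j\in J}$ satisfying property $(G)$, and let $\{\mathcal C_k\}_{k\in K}=\{(\{\mathfrak B_i\}_{i\in I};f_k)\}_{k\in K}$ be the collection of free Horn–Tarski partial probability theories associated to $\{\widetilde{\mathcal C}_k\}_{k\in K}$ and $\widetilde{\mathcal G}$. Then: (a) if, for a given $k\in K$, $\widetilde{\mathcal C}_k$ admits a classical representation, then $\mathcal C_k$ admits a classical representation; (b) if there exists $K'\subset K$ such that $\{\tilde f_k\}_{k\in K'}$ is separating for $\{\widetilde{\mathfrak B}_j\}_{j\in J}$ and $\mathcal C_k$ admits a classical representation for all $k\in K'$, then $\widetilde{\mathcal C}_k$ admits a classical representation for all $k\in K'$.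
   Context: **Partial Boolean algebra (PBA).** A set $X$ with a non-empty family $\mathcal F=\{\mathfrak B_i\}_{i\in I}$ of Boolean algebras with $\bigcup_i\mathfrak B_i=X$, such that $(P_1)$ for all $i,j$, $\mathfrak B_i\cap\mathfrak B_j\in\mathcal F$ and the Boolean operations of $\mathfrak B_i$ and $\mathfrak B_j$ coincide on it; $(P_2)$ every Boolean subalgebra of a member of $\mathcal F$ belongs to $\mathcal F$. All PBAs are assumed finite ($X$ finite). Operations are denoted $\cap,\cup,{}^c$, zero $\emptyset$, unit $\mathbf 1$. It is denoted $(X,\{\mathfrak B_i\})$ or $\{\mathfrak B_i\}$. **State.** A map $f:X\to[0,1]$ whose restriction to each $\mathfrak B_i$ is a normalized (finitely additive) measure. A **partial probability theory (PPT)** is a pair $(\{\mathfrak B_i\};f)$ of a PBA and a state on it. **Generators, compatibility.** A maximal (by inclusion) algebra of the PBA is a context. Elements are compatible if they belong to a common context (a set of elements is compatible if contained in a common context). A subset $\mathcal G\subset X$ generates the PBA if each maximal algebra is generated, as a Boolean algebra, by a subset of $\mathcal G$. **Classical representation** of a PPT $(\{\mathfrak B_i\};f)$, $X=\bigcup_i\mathfrak B_i$: a Boolean algebra $\mathfrak B$ with a normalized measure $\mu$ such that $X\subset\mathfrak B$, every $\mathfrak B_i$ is a Boolean subalgebra of $\mathfrak B$, $X$ generates $\mathfrak B$, and $\mu|_{\mathfrak B_i}=f|_{\mathfrak B_i}$ for all $i$ (elements being identified with their images under an embedding). **Complete / separating.** A collection of states $\{f_k\}$ on a PBA with underlying set $X$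 is complete if for every $A\in X$, $A\ne\emptyset$, some $f_k(A)\neq0$; it is separating if in addition for all $A\neq B$ in $X$ some $f_k(A)\ne f_k(B)$. **Property $(G)$** for a set of generators $\widetilde{\mathcal G}$: given $r\ge1$ maximal algebras $\widetilde{\mathfrak B}_{i_1},\dots,\widetilde{\mathfrak B}_{i_r}$, generated respectively by maximal subsets of compatible generators $\widetilde{\mathcal G}_{i_1},\dots,\widetilde{\mathcal G}_{i_r}\subset\widetilde{\mathcal G}$, such that $\widetilde{\mathfrak B}_{i_1}\cap\dots\cap\widetilde{\mathfrak B}_{i_r}\ne\{\emptyset,\mathbf 1\}$, the set $\widetilde{\mathcal G}_{i_1}\cap\dots\cap\widetilde{\mathcal G}_{i_r}$ is non-empty and generates the Boolean algebra $\widetilde{\mathfrak B}_{i_1}\cap\dots\cap\widetilde{\mathfrak B}_{i_r}$. **Associated free Horn–Tarski PPTs.** Let $\mathcal G=\{A_1,\dots,A_n\}$ be free generators (of a free Boolean algebra), with $A_i$ corresponding to $\widetilde A_i$. For each subset of compatible generators $\widetilde{\mathcal G}_l=\{\widetilde A_{s_1},\dots,\widetilde A_{s_{n_l}}\}\subset\widetilde{\mathcal G}$ put $\mathcal G_l=\{A_{s_1},\dots,A_{s_{n_l}}\}$. The PBA $\{\mathfrak B_i\}_{i\in I}$ consists of the Boolean algebras freely generated by the sets $\mathcal G_l$ (regarded as subalgebras of the Boolean algebra freely generated by $\mathcal G$), together with all their subalgebras. The state $f_k$ is defined on each maximal algebra, generated by $\mathcal G_l=\{A_{s_1},\dots,A_{s_{n_l}}\}$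 with $\widetilde{\mathcal G}_l$ a maximal compatible subset, by $$f_k\big((-1)^{1-\varepsilon_1}A_{s_1}\cap\dots\cap(-1)^{1-\varepsilon_{n_l}}A_{s_{n_l}}\big)=\tilde f_k\big((-1)^{1-\varepsilon_1}\widetilde A_{s_1}\cap\dots\cap(-1)^{1-\varepsilon_{n_l}}\widetilde A_{s_{n_l}}\big),\quad \varepsilon_i\in\{0,1\},$$ where $-A:=A^c$, and extended additively. *)

theory Defs
  imports Complex_Main "HOL-Library.Countable_Set"
begin

section \<open>Boolean algebras with explicit carrier\<close>

record 'a boolean_ops =
  bmeet :: "'a \<Rightarrow> 'a \<Rightarrow> 'a"
  bjoin :: "'a \<Rightarrow> 'a \<Rightarrow> 'a"
  bcompl :: "'a \<Rightarrow> 'a"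
  bzero :: 'a
  bone :: 'a

text \<open>The axioms of \<^locale>\<open>abstract_boolean_algebra\<close>, relativized to a carrier \<open>B\<close>.\<close>

definition boolean_algebra_on :: "('a, 'm) boolean_ops_scheme \<Rightarrow> 'a set \<Rightarrow> bool" where
  "boolean_algebra_on R B \<longleftrightarrow>
     bzero R \<in> B \<and> bone R \<in> B \<and>
     (\<forall>x\<in>B. bcompl R x \<in> B \<and>
        bmeet R x (bone R) = x \<and> bjoin R x (bzero R) = x \<and>
        bmeet R x (bcompl R x) = bzero R \<and> bjoin R x (bcompl R x) = bone R) \<and>
     (\<forall>x\<in>B. \<forall>y\<in>B. bmeet R x y \<in> B \<and> bjoin R x y \<in> B \<and>
        bmeet R x y = bmeet R y x \<and> bjoin R x y = bjoin R y x) \<and>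
     (\<forall>x\<in>B. \<forall>y\<in>B. \<forall>z\<in>B.
        bmeet R (bmeet R x y) z = bmeet R x (bmeet R y z) \<and>
        bjoin R (bjoin R x y) z = bjoin R x (bjoin R y z) \<and>
        bmeet R x (bjoin R y z) = bjoin R (bmeet R x y) (bmeet R x z) \<and>
        bjoin R x (bmeet R y z) = bmeet R (bjoin R x y) (bjoin R x z))"

lemma bool_alg:
  assumes "boolean_algebra_on R B"
  shows "bzero R \<in> B" "bone R \<in> B"
    "x \<in> B \<Longrightarrow> bcompl R x \<in> B"
    "x \<in> B \<Longrightarrow> y \<in> B \<Longrightarrow> bmeet R x y \<in> B"
    "x \<in> B \<Longrightarrow> y \<in> B \<Longrightarrow> bjoin R x y \<in> B"
    "x \<in> B \<Longrightarrow> bmeet R x (bone R) = x"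
    "x \<in> B \<Longrightarrow> bjoin R x (bzero R) = x"
    "x \<in> B \<Longrightarrow> bmeet R x (bcompl R x) = bzero R"
    "x \<in> B \<Longrightarrow> bjoin R x (bcompl R x) = bone R"
    "x \<in> B \<Longrightarrow> y \<in> B \<Longrightarrow> bmeet R x y = bmeet R y x"
    "x \<in> B \<Longrightarrow> y \<in> B \<Longrightarrow> bjoin R x y = bjoin R y x"
    "x \<in> B \<Longrightarrow> y \<in> B \<Longrightarrow> z \<in> B \<Longrightarrow>
       bmeet R (bmeet R x y) z = bmeet R x (bmeet R y z)"
    "x \<in> B \<Longrightarrow> y \<in> B \<Longrightarrow> z \<in> B \<Longrightarrow>
       bjoin R (bjoin R x y) z = bjoin R x (bjoin R y z)"
    "x \<in> B \<Longrightarrow> y \<in> B \<Longrightarrow> z \<in> B \<Longrightarrow>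
       bmeet R x (bjoin R y z) = bjoin R (bmeet R x y) (bmeet R x z)"
    "x \<in> B \<Longrightarrow> y \<in> B \<Longrightarrow> z \<in> B \<Longrightarrow>
       bjoin R x (bmeet R y z) = bmeet R (bjoin R x y) (bjoin R x z)"
  using assms unfolding boolean_algebra_on_def by blast+

definition subalgebra_on :: "('a, 'm) boolean_ops_scheme \<Rightarrow> 'a set \<Rightarrow> 'a set \<Rightarrow> bool" where
  "subalgebra_on R C B \<longleftrightarrow>
     C \<subseteq> B \<and> bzero R \<in> C \<and> bone R \<in> C \<and> (\<forall>x\<in>C. bcompl R x \<in> C) \<and>
     (\<forall>x\<in>C. \<forall>y\<in>C. bmeet R x y \<in> C \<and> bjoin R x y \<in> C)"

inductive_set generated :: "('a, 'm) boolean_ops_scheme \<Rightarrow> 'a set \<Rightarrow> 'a set"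
  for R :: "('a, 'm) boolean_ops_scheme" and S :: "'a set" where
  base: "x \<in> S \<Longrightarrow> x \<in> generated R S"
| zero: "bzero R \<in> generated R S"
| one: "bone R \<in> generated R S"
| compl: "x \<in> generated R S \<Longrightarrow> bcompl R x \<in> generated R S"
| meet: "x \<in> generated R S \<Longrightarrow> y \<in> generated R S \<Longrightarrow> bmeet R x y \<in> generated R S"
| join: "x \<in> generated R S \<Longrightarrow> y \<in> generated R S \<Longrightarrow> bjoin R x y \<in> generated R S"

definition normalized_measure ::
    "('a, 'm) boolean_ops_scheme \<Rightarrow> 'a set \<Rightarrow> ('a \<Rightarrow> real) \<Rightarrow> bool" where
  "normalized_measure R B \<mu> \<longleftrightarrow>
     (\<forall>x\<in>B. 0 \<le> \<mu> x) \<and> \<mu> (bone R) = 1 \<and>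
     (\<forall>x\<in>B. \<forall>y\<in>B. bmeet R x y = bzero R \<longrightarrow> \<mu> (bjoin R x y) = \<mu> x + \<mu> y)"


section \<open>Partial Boolean algebras and partial probability theories\<close>

text \<open>
  The members of the family are given by their carriers \<open>algs P\<close>. Since the operations of any
  two members coincide on their intersection, all members share one set of (partial) operations;
  the operations of the record represent it, and their values on arguments that do not lie in a
  common member are irrelevant.
\<close>

record 'a pba = "'a boolean_ops" +
  algs :: "'a set set"

definition elems :: "('a, 'm) pba_scheme \<Rightarrow> 'a set" where
  "elems P = \<Union>(algs P)"

definition is_pba :: "('a, 'm) pba_scheme \<Rightarrow> bool" where
  "is_pba P \<longleftrightarrow>
     algs P \<noteq> {} \<and> finite (elems P) \<and>
     (\<forall>B\<in>algs P. boolean_algebra_on P B) \<and>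
     (\<forall>B\<in>algs P. \<forall>C\<in>algs P. B \<inter> C \<in> algs P) \<and>
     (\<forall>B\<in>algs P. \<forall>C. subalgebra_on P C B \<longrightarrow> C \<in> algs P)"

definition is_state :: "('a, 'm) pba_scheme \<Rightarrow> ('a \<Rightarrow> real) \<Rightarrow> bool" where
  "is_state P f \<longleftrightarrow>
     (\<forall>x\<in>elems P. f x \<in> {0..1}) \<and> (\<forall>B\<in>algs P. normalized_measure P B f)"

definition is_ppt :: "('a, 'm) pba_scheme \<Rightarrow> ('a \<Rightarrow> real) \<Rightarrow> bool" where
  "is_ppt P f \<longleftrightarrow> is_pba P \<and> is_state P f"

definition is_context :: "('a, 'm) pba_scheme \<Rightarrow> 'a set \<Rightarrow> bool" where
  "is_context P B \<longleftrightarrow> B \<in> algs P \<and> (\<forall>C\<in>algs P. B \<subseteq> C \<longrightarrow> C = B)"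

definition compatible :: "('a, 'm) pba_scheme \<Rightarrow> 'a set \<Rightarrow> bool" where
  "compatible P S \<longleftrightarrow> (\<exists>B. is_context P B \<and> S \<subseteq> B)"

definition generates_pba :: "('a, 'm) pba_scheme \<Rightarrow> 'a set \<Rightarrow> bool" where
  "generates_pba P G \<longleftrightarrow>
     G \<subseteq> elems P \<and> (\<forall>B. is_context P B \<longrightarrow> (\<exists>S\<subseteq>G. generated P S = B))"

definition complete_states ::
    "('a, 'm) pba_scheme \<Rightarrow> 'k set \<Rightarrow> ('k \<Rightarrow> 'a \<Rightarrow> real) \<Rightarrow> bool" where
  "complete_states P K f \<longleftrightarrow> (\<forall>x\<in>elems P. x \<noteq> bzero P \<longrightarrow> (\<exists>k\<in>K. f k x \<noteq> 0))"

definition separating_states ::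
    "('a, 'm) pba_scheme \<Rightarrow> 'k set \<Rightarrow> ('k \<Rightarrow> 'a \<Rightarrow> real) \<Rightarrow> bool" where
  "separating_states P K f \<longleftrightarrow> complete_states P K f \<and>
     (\<forall>x\<in>elems P. \<forall>y\<in>elems P. x \<noteq> y \<longrightarrow> (\<exists>k\<in>K. f k x \<noteq> f k y))"


section \<open>Classical representations\<close>

text \<open>The map \<open>\<phi>\<close> is the embedding along which \<open>elems P\<close> is identified with a subset of \<open>B\<close>.\<close>

definition classical_representation ::
    "('a, 'm) pba_scheme \<Rightarrow> ('a \<Rightarrow> real) \<Rightarrow>
     ('b, 'n) boolean_ops_scheme \<Rightarrow> 'b set \<Rightarrow> ('b \<Rightarrow> real) \<Rightarrow> ('a \<Rightarrow> 'b) \<Rightarrow> bool" where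
  "classical_representation P f R B \<mu> \<phi> \<longleftrightarrow>
     boolean_algebra_on R B \<and> normalized_measure R B \<mu> \<and>
     inj_on \<phi> (elems P) \<and> \<phi> ` elems P \<subseteq> B \<and>
     (\<forall>C\<in>algs P.
        \<phi> (bzero P) = bzero R \<and> \<phi> (bone P) = bone R \<and>
        (\<forall>x\<in>C. \<phi> (bcompl P x) = bcompl R (\<phi> x)) \<and>
        (\<forall>x\<in>C. \<forall>y\<in>C. \<phi> (bmeet P x y) = bmeet R (\<phi> x) (\<phi> y) \<and>
                         \<phi> (bjoin P x y) = bjoin R (\<phi> x) (\<phi> y))) \<and>
     generated R (\<phi> ` elems P) = B \<and>
     (\<forall>C\<in>algs P. \<forall>x\<in>C. \<mu> (\<phi> x) = f x)"

text \<open>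
  An algebra generated by the finite set \<open>elems P\<close> is countable (in fact finite), so that
  restricting its elements to the type \<^typ>\<open>nat\<close> loses no generality; see
  \<open>admits_classical_representationI\<close> below.
\<close>

definition admits_classical_representation ::
    "('a, 'm) pba_scheme \<Rightarrow> ('a \<Rightarrow> real) \<Rightarrow> bool" where
  "admits_classical_representation P f \<longleftrightarrow>
     (\<exists>(R :: nat boolean_ops) B \<mu> \<phi>. classical_representation P f R B \<mu> \<phi>)"

lemma countable_generated:
  assumes "countable S"
  shows "countable (generated R S)"
proof -
  define F where "F T = T \<union> {bzero R, bone R} \<union> bcompl R ` T \<union>
    (\<lambda>(x, y). bmeet R x y) ` (T \<times> T) \<union> (\<lambda>(x, y). bjoin R x y) ` (T \<times> T)" for T
  define U where "U n = (F ^^ n) S" for n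
  have U_Suc: "U (Suc n) = F (U n)" for n by (simp add: U_def)
  have cnt: "countable (U n)" for n
    by (induction n) (auto simp: U_Suc F_def assms, simp add: U_def assms)
  have step: "U n \<subseteq> U (Suc n)" for n by (auto simp: U_Suc F_def)
  have mono: "U m \<subseteq> U n" if "m \<le> n" for m n
    using lift_Suc_mono_le[of U, OF step that] .
  have "x \<in> (\<Union>n. U n)" if "x \<in> generated R S" for x
    using that
  proof induction
    case (base x)
    then have "x \<in> U 0" by (simp add: U_def)
    then show ?case by blast
  next
    case zero
    have "bzero R \<in> U (Suc 0)" by (simp add: U_Suc F_def)
    then show ?case by blast
  next
    case one
    have "bone R \<in> U (Suc 0)" by (simp add: U_Suc F_def)
    then show ?case by blast
  next
    case (compl x)
    then obtain n where "x \<in> U n" by blast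
    then have "bcompl R x \<in> U (Suc n)" by (simp add: U_Suc F_def)
    then show ?case by blast
  next
    case (meet x y)
    then obtain m n where "x \<in> U m" "y \<in> U n" by blast
    then have "x \<in> U (max m n)" "y \<in> U (max m n)"
      using mono[of m "max m n"] mono[of n "max m n"] by auto
    then have "bmeet R x y \<in> U (Suc (max m n))" by (force simp: U_Suc F_def)
    then show ?case by blast
  next
    case (join x y)
    then obtain m n where "x \<in> U m" "y \<in> U n" by blast
    then have "x \<in> U (max m n)" "y \<in> U (max m n)"
      using mono[of m "max m n"] mono[of n "max m n"] by auto
    then have "bjoin R x y \<in> U (Suc (max m n))" by (force simp: U_Suc F_def)
    then show ?case by blast
  qed
  then have "generated R S \<subseteq> (\<Union>n. U n)" by blast
  moreover have "countable (\<Union>n. U n)" using cnt by simp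
  ultimately show ?thesis by (rule countable_subset)
qed

lemma admits_classical_representationI:
  assumes P: "is_pba P" and rep: "classical_representation P f R B \<mu> \<phi>"
  shows "admits_classical_representation P f"
proof -
  note r = rep[unfolded classical_representation_def]
  have gen: "generated R (\<phi> ` elems P) = B" using r by blast
  have "finite (elems P)" using P by (simp add: is_pba_def)
  then have "countable B"
    using countable_generated[of "\<phi> ` elems P" R] gen by (simp add: countable_finite)
  define e where "e = to_nat_on B"
  define g where "g = inv_into B e"
  have inj: "inj_on e B" using \<open>countable B\<close> by (simp add: e_def inj_on_to_nat_on)
  have ge: "g (e x) = x" if "x \<in> B" for x using inj that by (simp add: g_def)
  define R' where "R' = \<lparr>bmeet = (\<lambda>x y. e (bmeet R (g x) (g y))),
    bjoin = (\<lambda>x y. e (bjoin R (g x) (g y))), bcompl = (\<lambda>x. e (bcompl R (g x))),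
    bzero = e (bzero R), bone = e (bone R)\<rparr>"
  have ba: "boolean_algebra_on R B" using r by blast
  have cl: "bzero R \<in> B" "bone R \<in> B" "\<And>x. x \<in> B \<Longrightarrow> bcompl R x \<in> B"
    "\<And>x y. x \<in> B \<Longrightarrow> y \<in> B \<Longrightarrow> bmeet R x y \<in> B"
    "\<And>x y. x \<in> B \<Longrightarrow> y \<in> B \<Longrightarrow> bjoin R x y \<in> B"
    using bool_alg(1-5)[OF ba] by blast+
  have ops: "bzero R' = e (bzero R)" "bone R' = e (bone R)"
    "\<And>x. x \<in> B \<Longrightarrow> bcompl R' (e x) = e (bcompl R x)"
    "\<And>x y. x \<in> B \<Longrightarrow> y \<in> B \<Longrightarrow> bmeet R' (e x) (e y) = e (bmeet R x y)"
    "\<And>x y. x \<in> B \<Longrightarrow> y \<in> B \<Longrightarrow> bjoin R' (e x) (e y) = e (bjoin R x y)"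
    by (simp_all add: R'_def ge)
  have ba': "boolean_algebra_on R' (e ` B)"
    unfolding boolean_algebra_on_def
    by (intro conjI ballI; (elim imageE)?; simp add: ops cl;
        rule arg_cong[where f = e]; rule bool_alg[OF ba]; assumption)
  have ms: "normalized_measure R' (e ` B) (\<mu> \<circ> g)"
  proof -
    have "normalized_measure R B \<mu>" using r by blast
    then show ?thesis
      using cl by (auto simp: normalized_measure_def ops ge inj_on_eq_iff[OF inj])
  qed
  have sub: "\<phi> ` elems P \<subseteq> B" using r by blast
  have "e ` generated R (\<phi> ` elems P) \<subseteq> generated R' ((e \<circ> \<phi>) ` elems P)"
  proof
    fix y assume "y \<in> e ` generated R (\<phi> ` elems P)"
    then obtain x where y: "y = e x" and "x \<in> generated R (\<phi> ` elems P)" by blast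
    from this(2) have "e x \<in> generated R' ((e \<circ> \<phi>) ` elems P)"
    proof induction
      case (base x) then show ?case by (force intro: generated.base)
    next
      case zero then show ?case using generated.zero[of R'] by (simp add: ops)
    next
      case one then show ?case using generated.one[of R'] by (simp add: ops)
    next
      case (compl x)
      then show ?case using generated.compl[of "e x" R'] gen by (simp add: ops)
    next
      case (meet x y)
      then show ?case using generated.meet[of "e x" R' _ "e y"] gen by (simp add: ops)
    next
      case (join x y)
      then show ?case using generated.join[of "e x" R' _ "e y"] gen by (simp add: ops)
    qed
    then show "y \<in> generated R' ((e \<circ> \<phi>) ` elems P)" by (simp add: y)
  qed
  moreover have "z \<in> e ` B" if "z \<in> generated R' ((e \<circ> \<phi>) ` elems P)" for z
    using that sub by induction (auto simp: ops cl)
  ultimately have gen': "generated R' ((e \<circ> \<phi>) ` elems P) = e ` B" using gen by blast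
  have inB: "\<phi> x \<in> B" if "x \<in> C" "C \<in> algs P" for x C
    using sub that by (auto simp: elems_def)
  have "inj_on (e \<circ> \<phi>) (elems P)"
    using r inj sub by (meson comp_inj_on inj_on_subset)
  then have "classical_representation P f R' (e ` B) (\<mu> \<circ> g) (e \<circ> \<phi>)"
    unfolding classical_representation_def
    using ba' ms gen' sub r inB by (auto simp: ops ge)
  then show ?thesis unfolding admits_classical_representation_def by blast
qed


section \<open>Property (G) and the associated free Horn--Tarski theories\<close>

definition maximal_compatible :: "('a, 'm) pba_scheme \<Rightarrow> 'a set \<Rightarrow> 'a set \<Rightarrow> bool" where
  "maximal_compatible P G S \<longleftrightarrow>
     S \<subseteq> G \<and> compatible P S \<and> (\<forall>T. S \<subseteq> T \<and> T \<subseteq> G \<and> compatible P T \<longrightarrow> T = S)"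

definition property_G :: "('a, 'm) pba_scheme \<Rightarrow> 'a set \<Rightarrow> bool" where
  "property_G P G \<longleftrightarrow>
     (\<forall>(r::nat) Bs Gs. r \<ge> 1 \<and>
        (\<forall>l<r. is_context P (Bs l) \<and> maximal_compatible P G (Gs l) \<and>
               generated P (Gs l) = Bs l) \<and>
        (\<Inter>l<r. Bs l) \<noteq> {bzero P, bone P} \<longrightarrow>
        (\<Inter>l<r. Gs l) \<noteq> {} \<and> generated P (\<Inter>l<r. Gs l) = (\<Inter>l<r. Bs l))"

text \<open>
  The free Boolean algebra on a finite set \<open>G\<close> is realized as \<open>Pow (Pow G)\<close>: its elements are the
  sets of truth assignments of \<open>G\<close>, an assignment being given by the set of generators it makes
  true. The free generator that corresponds to \<open>a \<in> G\<close> is \<open>free_gen G a\<close>.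
\<close>

definition free_ops :: "'a set \<Rightarrow> 'a set set boolean_ops" where
  "free_ops G = \<lparr>bmeet = (\<inter>), bjoin = (\<union>), bcompl = (\<lambda>E. Pow G - E), bzero = {}, bone = Pow G\<rparr>"

definition free_gen :: "'a set \<Rightarrow> 'a \<Rightarrow> 'a set set" where
  "free_gen G a = {v \<in> Pow G. a \<in> v}"

definition free_HT_pba :: "('a, 'm) pba_scheme \<Rightarrow> 'a set \<Rightarrow> 'a set set pba" where
  "free_HT_pba P G = boolean_ops.extend (free_ops G)
     (pba.fields {C. \<exists>S\<subseteq>G. compatible P S \<and>
                     subalgebra_on (free_ops G) C (generated (free_ops G) (free_gen G ` S))})"

text \<open>
  \<open>signed_meet R \<epsilon> h [s\<^sub>1, \<dots>, s\<^sub>m]\<close> is the meet of the elements \<open>h s\<^sub>i\<close> (where \<open>\<epsilon> s\<^sub>i\<close>)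
  and of the complements of \<open>h s\<^sub>i\<close> (where not \<open>\<epsilon> s\<^sub>i\<close>).
\<close>

definition signed_meet ::
    "('b, 'm) boolean_ops_scheme \<Rightarrow> ('a \<Rightarrow> bool) \<Rightarrow> ('a \<Rightarrow> 'b) \<Rightarrow> 'a list \<Rightarrow> 'b" where
  "signed_meet R \<epsilon> h xs =
     foldr (bmeet R) (map (\<lambda>a. if \<epsilon> a then h a else bcompl R (h a)) xs) (bone R)"

text \<open>
  \<open>f\<close> is the state induced on \<open>free_HT_pba P G\<close> by the state \<open>f'\<close> on \<open>P\<close>. The conditions determine
  \<open>f\<close> on \<open>elems (free_HT_pba P G)\<close>; existence is \<open>free_HT_state_exists\<close> below.
\<close>

definition free_HT_state ::
    "('a, 'm) pba_scheme \<Rightarrow> 'a set \<Rightarrow> ('a \<Rightarrow> real) \<Rightarrow> ('a set set \<Rightarrow> real) \<Rightarrow> bool" where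
  "free_HT_state P G f' f \<longleftrightarrow>
     (\<forall>S. maximal_compatible P G S \<longrightarrow>
        (\<forall>xs \<epsilon>. distinct xs \<and> set xs = S \<longrightarrow>
           f (signed_meet (free_ops G) \<epsilon> (free_gen G) xs) = f' (signed_meet P \<epsilon> (\<lambda>a. a) xs)) \<and>
        (\<forall>E\<in>generated (free_ops G) (free_gen G ` S).
         \<forall>E'\<in>generated (free_ops G) (free_gen G ` S).
           E \<inter> E' = {} \<longrightarrow> f (E \<union> E') = f E + f E'))"

lemma free_ops_simps [simp]:
  "bmeet (free_ops G) = (\<inter>)" "bjoin (free_ops G) = (\<union>)"
  "bcompl (free_ops G) E = Pow G - E" "bzero (free_ops G) = {}" "bone (free_ops G) = Pow G"
  by (simp_all add: free_ops_def)

lemma free_HT_pba_simps [simp]: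
  "bmeet (free_HT_pba P G) = (\<inter>)" "bjoin (free_HT_pba P G) = (\<union>)"
  "bcompl (free_HT_pba P G) E = Pow G - E"
  "bzero (free_HT_pba P G) = {}" "bone (free_HT_pba P G) = Pow G"
  "algs (free_HT_pba P G) = {C. \<exists>S\<subseteq>G. compatible P S \<and>
     subalgebra_on (free_ops G) C (generated (free_ops G) (free_gen G ` S))}"
  by (simp_all add: free_HT_pba_def boolean_ops.defs pba.defs free_ops_def)

lemma subalgebra_on_free_HT_pba [simp]:
  "subalgebra_on (free_HT_pba P G) = subalgebra_on (free_ops G)"
  by (simp add: subalgebra_on_def fun_eq_iff)

lemma generated_mono: "S \<subseteq> T \<Longrightarrow> generated R S \<subseteq> generated R T"
proof
  fix x assume "S \<subseteq> T" "x \<in> generated R S"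
  from this(2) show "x \<in> generated R T"
    by induction (use \<open>S \<subseteq> T\<close> in \<open>auto intro: generated.intros\<close>)
qed

lemma generated_subset:
  assumes "boolean_algebra_on R B" "S \<subseteq> B"
  shows "generated R S \<subseteq> B"
proof
  fix x assume "x \<in> generated R S"
  then show "x \<in> B"
    by induction (use assms(2) bool_alg(1-5)[OF assms(1)] in auto)
qed

lemma generated_free_iff:
  assumes "E \<in> generated (free_ops G) (free_gen G ` S)" "S \<subseteq> G" "v \<subseteq> G"
  shows "v \<in> E \<longleftrightarrow> v \<inter> S \<in> E"
  using assms(1)
proof induction
  case (base E)
  then show ?case using assms(2,3) by (auto simp: free_gen_def)
qed (use assms(2,3) in \<open>auto\<close>)

lemma generated_free_subset: "generated (free_ops G) (free_gen G ` S) \<subseteq> Pow (Pow G)"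
proof
  fix E assume "E \<in> generated (free_ops G) (free_gen G ` S)"
  then show "E \<in> Pow (Pow G)" by induction (auto simp: free_gen_def)
qed

lemma context_exists:
  assumes P: "is_pba P" and B: "B \<in> algs P"
  obtains C where "is_context P C" "B \<subseteq> C"
proof -
  have "finite (algs P)"
    using P by (simp add: is_pba_def elems_def finite_UnionD)
  then obtain C where "C \<in> algs P" "B \<subseteq> C" "\<forall>D\<in>algs P. C \<subseteq> D \<longrightarrow> C = D"
    using finite_has_maximal2[of "algs P" B] B by auto
  then show thesis using that[of C] by (auto simp: is_context_def)
qed

lemma maximal_compatible_exists:
  assumes "finite G" "S \<subseteq> G" "compatible P S"
  obtains T where "maximal_compatible P G T" "S \<subseteq> T"
proof -
  have "finite {T. T \<subseteq> G \<and> compatible P T}" using assms(1) by simp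
  then obtain T where "T \<subseteq> G" "compatible P T" "S \<subseteq> T"
    "\<forall>U\<in>{T. T \<subseteq> G \<and> compatible P T}. T \<subseteq> U \<longrightarrow> T = U"
    using finite_has_maximal2[of "{T. T \<subseteq> G \<and> compatible P T}" S] assms by auto
  then have "maximal_compatible P G T" unfolding maximal_compatible_def by blast
  then show thesis using \<open>S \<subseteq> T\<close> that by blast
qed

lemma free_HT_pba_is_pba:
  assumes P: "is_pba P" and "G \<subseteq> elems P"
  shows "is_pba (free_HT_pba P G)"
proof -
  let ?F = "\<lambda>S. generated (free_ops G) (free_gen G ` S)"
  have G: "finite G" using assms by (meson is_pba_def finite_subset)
  obtain C where "is_context P C" using context_exists[OF P] P by (metis is_pba_def ex_in_conv)
  then have "compatible P {}" by (auto simp: compatible_def)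
  moreover have "subalgebra_on (free_ops G) (?F {}) (?F {})"
    unfolding subalgebra_on_def by (blast intro: generated.intros)
  ultimately have ne: "algs (free_HT_pba P G) \<noteq> {}"
    unfolding free_HT_pba_simps by blast
  have sub: "B \<subseteq> Pow (Pow G)" if "subalgebra_on (free_ops G) B (?F S)" for B S
    using that generated_free_subset[of G S] unfolding subalgebra_on_def by blast
  have "elems (free_HT_pba P G) \<subseteq> Pow (Pow G)"
    unfolding elems_def free_HT_pba_simps using sub by blast
  then have fin: "finite (elems (free_HT_pba P G))"
    using G by (meson finite_Pow_iff finite_subset)
  have ba: "boolean_algebra_on (free_HT_pba P G) B"
    if B: "subalgebra_on (free_ops G) B (?F S)" for B S
    using sub[OF B] B unfolding boolean_algebra_on_def subalgebra_on_def
    unfolding free_ops_simps free_HT_pba_simps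
    by (intro conjI ballI) blast+
  have int: "subalgebra_on (free_ops G) (B \<inter> C) (?F S)"
    if "subalgebra_on (free_ops G) B (?F S)" "subalgebra_on (free_ops G) C (?F T)" for B C S T
    using that unfolding subalgebra_on_def by blast
  have trans: "subalgebra_on (free_ops G) C (?F S)"
    if "subalgebra_on (free_ops G) B (?F S)" "subalgebra_on (free_ops G) C B" for B C S
    using that unfolding subalgebra_on_def by blast
  show ?thesis
    unfolding is_pba_def subalgebra_on_free_HT_pba
  proof (intro conjI ballI allI impI)
    fix B assume "B \<in> algs (free_HT_pba P G)"
    then obtain S where S: "S \<subseteq> G" "compatible P S" "subalgebra_on (free_ops G) B (?F S)"
      unfolding free_HT_pba_simps by blast
    show "boolean_algebra_on (free_HT_pba P G) B" using ba[OF S(3)] .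
    show "B \<inter> C \<in> algs (free_HT_pba P G)" if C: "C \<in> algs (free_HT_pba P G)" for C
      using S(1,2) int[OF S(3)] C unfolding free_HT_pba_simps by blast
    show "C \<in> algs (free_HT_pba P G)" if C: "subalgebra_on (free_ops G) C B" for C
      using S(1,2) trans[OF S(3) C] unfolding free_HT_pba_simps by blast
  qed (fact ne fin)+
qed

lemma signed_meet_Cons:
  "signed_meet R \<epsilon> h (a # xs) =
     bmeet R (if \<epsilon> a then h a else bcompl R (h a)) (signed_meet R \<epsilon> h xs)"
  by (simp add: signed_meet_def)

lemma signed_meet_cong:
  "(\<And>a. a \<in> set xs \<Longrightarrow> \<epsilon> a = \<delta> a) \<Longrightarrow> signed_meet R \<epsilon> h xs = signed_meet R \<delta> h xs"
  unfolding signed_meet_def by (intro arg_cong2[where f = "\<lambda>l. foldr (bmeet R) l"] map_cong) auto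

lemma signed_meet_closed:
  assumes "boolean_algebra_on R B" "h ` set xs \<subseteq> B"
  shows "signed_meet R \<epsilon> h xs \<in> B"
  using assms(2)
proof (induction xs)
  case Nil
  then show ?case using bool_alg(2)[OF assms(1)] by (simp add: signed_meet_def)
next
  case (Cons a xs)
  then show ?case using bool_alg(3,4)[OF assms(1)] by (auto simp: signed_meet_Cons)
qed

lemma signed_meet_move:
  assumes B: "boolean_algebra_on R B" "h ` set (ys @ a # zs) \<subseteq> B"
  shows "signed_meet R \<epsilon> h (ys @ a # zs) = signed_meet R \<epsilon> h (a # ys @ zs)"
  using assms(2)
proof (induction ys)
  case (Cons b ys)
  define p q where "p = (if \<epsilon> a then h a else bcompl R (h a))"
    and "q = (if \<epsilon> b then h b else bcompl R (h b))"
  define m where "m = signed_meet R \<epsilon> h (ys @ zs)"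
  have "h a \<in> B" "h b \<in> B" using Cons.prems by auto
  then have pq: "p \<in> B" "q \<in> B" using bool_alg(3)[OF B(1)] by (auto simp: p_def q_def)
  have m: "m \<in> B" unfolding m_def using Cons.prems by (intro signed_meet_closed[OF B(1)]) auto
  have "bmeet R q (bmeet R p m) = bmeet R p (bmeet R q m)"
    using bool_alg(12)[OF B(1) pq m] bool_alg(12)[OF B(1) pq(2,1) m] bool_alg(10)[OF B(1) pq] by simp
  then show ?case using Cons by (simp add: signed_meet_Cons p_def q_def m_def)
qed simp

lemma signed_meet_perm:
  assumes B: "boolean_algebra_on R B"
    and "h ` set xs \<subseteq> B" "distinct xs" "distinct ys" "set xs = set ys"
  shows "signed_meet R \<epsilon> h xs = signed_meet R \<epsilon> h ys"
  using assms(2-)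
proof (induction xs arbitrary: ys)
  case (Cons a xs)
  then have "a \<in> set ys" by auto
  then obtain us vs where ys: "ys = us @ a # vs" by (meson split_list)
  have sub: "h ` set ys \<subseteq> B" using Cons.prems(1,4) by (simp only:)
  have "set xs = set (us @ vs)" using Cons.prems by (auto simp: ys)
  then have "signed_meet R \<epsilon> h xs = signed_meet R \<epsilon> h (us @ vs)"
    using Cons.prems by (intro Cons.IH) (auto simp: ys)
  then have "signed_meet R \<epsilon> h (a # xs) = signed_meet R \<epsilon> h (a # us @ vs)"
    by (simp add: signed_meet_Cons)
  also have "\<dots> = signed_meet R \<epsilon> h ys"
    using sub unfolding ys by (rule signed_meet_move[OF B, symmetric])
  finally show ?case .
qed simp

lemma measure_split:
  assumes B: "boolean_algebra_on R B" and \<mu>: "normalized_measure R B \<mu>" and x: "x \<in> B" and y: "y \<in> B"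
  shows "\<mu> (bmeet R x y) + \<mu> (bmeet R (bcompl R x) y) = \<mu> y"
proof -
  let ?c = "bcompl R x"
  note b = bool_alg[OF B]
  have c: "?c \<in> B" using b(3) x .
  have xy: "bmeet R x y \<in> B" and cy: "bmeet R ?c y \<in> B" using b(4) x y c by blast+
  have z: "bmeet R y (bzero R) = bzero R"
  proof -
    have yz: "bmeet R y (bzero R) \<in> B" and yc: "bcompl R y \<in> B" using b(1,3,4) y by blast+
    have "bmeet R y (bzero R) = bjoin R (bzero R) (bmeet R y (bzero R))"
      using b(7)[OF yz] b(11)[OF b(1) yz] by simp
    also have "\<dots> = bmeet R y (bjoin R (bcompl R y) (bzero R))"
      using b(14)[OF y yc b(1)] b(8)[OF y] by simp
    also have "\<dots> = bzero R" using b(7)[OF yc] b(8)[OF y] by simp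
    finally show ?thesis .
  qed
  have j: "bjoin R (bmeet R x y) (bmeet R ?c y) = y"
    using b(10)[OF x y] b(10)[OF c y] b(14)[OF y x c] b(9)[OF x] b(6)[OF y] by simp
  have "bmeet R (bmeet R x y) (bmeet R ?c y) = bmeet R y (bmeet R x (bmeet R ?c y))"
    using b(10)[OF x y] b(12)[OF y x cy] by simp
  also have "\<dots> = bmeet R y (bmeet R y (bzero R))"
    using b(12)[OF x c y] b(8)[OF x] b(10)[OF b(1) y] by simp
  also have "\<dots> = bzero R" using z by simp
  finally have "\<mu> (bjoin R (bmeet R x y) (bmeet R ?c y)) = \<mu> (bmeet R x y) + \<mu> (bmeet R ?c y)"
    using \<mu> xy cy unfolding normalized_measure_def by blast
  then show ?thesis using j by simp
qed

lemma sum_signed_meet_marginal: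
  assumes B: "boolean_algebra_on R B" and \<mu>: "normalized_measure R B \<mu>"
    and "set ys \<union> set xs \<subseteq> B" "distinct (ys @ xs)"
    and "\<And>w. w \<subseteq> set (ys @ xs) \<Longrightarrow> Q w \<longleftrightarrow> Q (w \<inter> set xs)"
  shows "(\<Sum>w\<in>{w \<in> Pow (set (ys @ xs)). Q w}. \<mu> (signed_meet R (\<lambda>a. a \<in> w) (\<lambda>a. a) (ys @ xs))) =
         (\<Sum>w\<in>{w \<in> Pow (set xs). Q w}. \<mu> (signed_meet R (\<lambda>a. a \<in> w) (\<lambda>a. a) xs))"
  using assms(3-)
proof (induction ys)
  case (Cons a ys)
  let ?T = "set (ys @ xs)"
  let ?W = "{w \<in> Pow ?T. Q w}"
  let ?m = "\<lambda>w zs. \<mu> (signed_meet R (\<lambda>a. a \<in> w) (\<lambda>a. a) zs)"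
  have a: "a \<notin> ?T" "a \<in> B" using Cons.prems by auto
  have Q: "Q (insert a w) \<longleftrightarrow> Q w" if "w \<subseteq> ?T" for w
  proof -
    have "Q (insert a w) \<longleftrightarrow> Q (insert a w \<inter> set xs)"
      using that by (intro Cons.prems(3)) auto
    also have "insert a w \<inter> set xs = w \<inter> set xs" using a by auto
    also have "Q \<dots> \<longleftrightarrow> Q w" using that by (intro Cons.prems(3)[symmetric]) auto
    finally show ?thesis .
  qed
  have split: "{w \<in> Pow (set ((a # ys) @ xs)). Q w} = ?W \<union> insert a ` ?W"
    using Q by (auto simp: Pow_insert)
  have inj: "inj_on (insert a) ?W" using a by (auto intro!: inj_onI)
  have closed: "signed_meet R (\<lambda>a. a \<in> w) (\<lambda>a. a) (ys @ xs) \<in> B" for w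
    using Cons.prems by (intro signed_meet_closed[OF B]) auto
  have eq: "signed_meet R (\<lambda>b. b \<in> insert a w) (\<lambda>a. a) (ys @ xs) =
      signed_meet R (\<lambda>b. b \<in> w) (\<lambda>a. a) (ys @ xs)" for w
    using a by (intro signed_meet_cong) auto
  have "(\<Sum>w\<in>{w \<in> Pow (set ((a # ys) @ xs)). Q w}. ?m w ((a # ys) @ xs)) =
      (\<Sum>w\<in>?W. ?m w (a # ys @ xs)) + (\<Sum>w\<in>insert a ` ?W. ?m w (a # ys @ xs))"
    unfolding split using a by (subst sum.union_disjoint) auto
  also have "\<dots> = (\<Sum>w\<in>?W. ?m w (a # ys @ xs) + ?m (insert a w) (a # ys @ xs))"
    by (subst sum.reindex[OF inj]) (simp only: comp_def sum.distrib)
  also have "\<dots> = (\<Sum>w\<in>?W. ?m w (ys @ xs))"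
  proof (rule sum.cong)
    fix w assume "w \<in> ?W"
    then have "a \<notin> w" using a by auto
    then show "?m w (a # ys @ xs) + ?m (insert a w) (a # ys @ xs) = ?m w (ys @ xs)"
      using measure_split[OF B \<mu> a(2) closed[of w]]
      by (simp add: signed_meet_Cons eq[simplified])
  qed simp
  also have "\<dots> = (\<Sum>w\<in>{w \<in> Pow (set xs). Q w}. ?m w xs)"
  proof (rule Cons.IH)
    fix w assume "w \<subseteq> set (ys @ xs)"
    then show "Q w \<longleftrightarrow> Q (w \<inter> set xs)" by (intro Cons.prems(3)) auto
  qed (use Cons.prems in auto)
  finally show ?case .
qed simp

lemma free_HT_state_exists:
  assumes PPT: "is_ppt P f'" and G: "G \<subseteq> elems P"
  obtains f where "free_HT_state P G f' f" "is_ppt (free_HT_pba P G) f"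
proof -
  let ?F = "\<lambda>S. generated (free_ops G) (free_gen G ` S)"
  let ?s = "\<lambda>w xs. signed_meet P (\<lambda>a. a \<in> w) (\<lambda>a. a) xs"
  have P: "is_pba P" using PPT by (simp add: is_ppt_def)
  have finG: "finite G" using P G by (meson is_pba_def finite_subset)
  define en where "en S = (SOME xs. distinct xs \<and> set xs = S)" for S :: "'a set"
  have en: "distinct (en S)" "set (en S) = S" if "S \<subseteq> G" for S
    using someI_ex[OF finite_distinct_list[OF finite_subset[OF that finG]]]
    by (auto simp: en_def conj_commute)
  define g where "g S E = (\<Sum>w\<in>{w \<in> Pow S. w \<in> E}. f' (?s w (en S)))" for S E
  have ctx: "\<exists>B. S \<subseteq> B \<and> boolean_algebra_on P B \<and> normalized_measure P B f'"
    if "compatible P S" for S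
    using that PPT unfolding compatible_def is_context_def is_ppt_def is_pba_def is_state_def by blast
  have g_sub: "g S E = g T E"
    if T: "S \<subseteq> G" "compatible P S" "T \<subseteq> S" and E: "\<And>w. w \<subseteq> S \<Longrightarrow> w \<in> E \<longleftrightarrow> w \<inter> T \<in> E" for S T E
  proof -
    obtain B where B: "S \<subseteq> B" "boolean_algebra_on P B" "normalized_measure P B f'"
      using ctx[OF T(2)] by blast
    let ?l = "en (S - T) @ en T"
    have s: "set (en (S - T)) = S - T" "set (en T) = T" "set (en S) = S"
      "distinct (en (S - T))" "distinct (en T)" "distinct (en S)"
      using T en by (meson Diff_subset order_trans)+
    have "g S E = (\<Sum>w\<in>{w \<in> Pow S. w \<in> E}. f' (?s w ?l))"
      unfolding g_def using s B(1) T(3)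
      by (intro sum.cong refl arg_cong[where f = f'] signed_meet_perm[OF B(2)]) auto
    also have "\<dots> = (\<Sum>w\<in>{w \<in> Pow (set ?l). w \<in> E}. f' (?s w ?l))"
      using s T(3) by (intro sum.cong) auto
    also have "\<dots> = (\<Sum>w\<in>{w \<in> Pow (set (en T)). w \<in> E}. f' (?s w (en T)))"
    proof (rule sum_signed_meet_marginal[OF B(2,3)])
      show "w \<in> E \<longleftrightarrow> w \<inter> set (en T) \<in> E" if "w \<subseteq> set ?l" for w
      proof -
        have "w \<subseteq> S" using that s T(3) by auto
        then show ?thesis using E[of w] s by simp
      qed
    qed (use s T B(1) in auto)
    also have "\<dots> = g T E" by (simp add: g_def s)
    finally show ?thesis .
  qed
  have g_eq: "g S E = g T E"
    if "S \<subseteq> G" "compatible P S" "T \<subseteq> G" "compatible P T" "E \<in> ?F S" "E \<in> ?F T" for S T E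
  proof -
    have "w \<in> E \<longleftrightarrow> w \<inter> (S \<inter> T) \<in> E" if "w \<subseteq> G" for w
    proof -
      have "w \<in> E \<longleftrightarrow> w \<inter> S \<in> E"
        using generated_free_iff[OF \<open>E \<in> ?F S\<close> \<open>S \<subseteq> G\<close> that] .
      also have "\<dots> \<longleftrightarrow> w \<inter> S \<inter> T \<in> E"
        using generated_free_iff[OF \<open>E \<in> ?F T\<close> \<open>T \<subseteq> G\<close>, of "w \<inter> S"] that by blast
      finally show ?thesis by (simp add: Int_assoc)
    qed
    then have "g S E = g (S \<inter> T) E" "g T E = g (S \<inter> T) E"
      using that by (auto intro!: g_sub)
    then show ?thesis by simp
  qed
  define f where
    "f E = g (SOME S. S \<subseteq> G \<and> compatible P S \<and> E \<in> ?F S) E" for E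
  have f: "f E = g S E" if "S \<subseteq> G" "compatible P S" "E \<in> ?F S" for S E
  proof -
    let ?S = "SOME S. S \<subseteq> G \<and> compatible P S \<and> E \<in> ?F S"
    have "?S \<subseteq> G \<and> compatible P ?S \<and> E \<in> ?F ?S" by (rule someI[of _ S]) (use that in blast)
    then show ?thesis unfolding f_def using that by (intro g_eq) auto
  qed
  have finS: "finite S" if "S \<subseteq> G" for S using that finG by (rule finite_subset)
  have add: "f (E \<union> E') = f E + f E'"
    if "S \<subseteq> G" "compatible P S" "E \<in> ?F S" "E' \<in> ?F S" "E \<inter> E' = {}" for S E E'
  proof -
    have "E \<union> E' \<in> ?F S" using generated.join[OF that(3,4)] by simp
    then have "f (E \<union> E') = g S (E \<union> E')" using that by (intro f)
    also have "\<dots> = (\<Sum>w\<in>{w \<in> Pow S. w \<in> E} \<union> {w \<in> Pow S. w \<in> E'}. f' (?s w (en S)))"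
      unfolding g_def by (intro sum.cong) auto
    also have "\<dots> = g S E + g S E'"
      unfolding g_def using that finS by (intro sum.union_disjoint) auto
    finally show ?thesis using f that by simp
  qed
  have atom: "f (signed_meet (free_ops G) \<epsilon> (free_gen G) xs) = f' (signed_meet P \<epsilon> (\<lambda>a. a) xs)"
    if S: "S \<subseteq> G" "compatible P S" and xs: "distinct xs" "set xs = S" for S xs \<epsilon>
  proof -
    let ?E = "signed_meet (free_ops G) \<epsilon> (free_gen G) xs"
    let ?w = "{a \<in> S. \<epsilon> a}"
    obtain B where B: "S \<subseteq> B" "boolean_algebra_on P B" "normalized_measure P B f'"
      using ctx[OF S(2)] by blast
    have "set ys \<subseteq> S \<Longrightarrow> signed_meet (free_ops G) \<epsilon> (free_gen G) ys \<in> ?F S" for ys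
    proof (induction ys)
      case Nil
      then show ?case using generated.one[of "free_ops G"] by (simp add: signed_meet_def)
    next
      case (Cons a ys)
      have "free_gen G a \<in> ?F S" using Cons.prems by (auto intro: generated.base)
      then show ?case using Cons unfolding signed_meet_Cons
        by (auto intro!: generated.meet[of _ "free_ops G", unfolded free_ops_simps]
            generated.compl[of _ "free_ops G", unfolded free_ops_simps])
    qed
    then have "?E \<in> ?F S" using xs by simp
    have "signed_meet (free_ops G) \<epsilon> (free_gen G) ys = {v \<in> Pow G. \<forall>a\<in>set ys. (a \<in> v) = \<epsilon> a}" for ys
      by (induction ys) (auto simp: signed_meet_Cons free_gen_def, auto simp: signed_meet_def)
    then have "{w \<in> Pow S. w \<in> ?E} = {?w}" using S(1) xs by auto
    then have "g S ?E = f' (?s ?w (en S))" by (simp add: g_def)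
    also have "?s ?w (en S) = ?s ?w xs"
      using en[OF S(1)] xs B(1) by (intro signed_meet_perm[OF B(2)]) auto
    also have "\<dots> = signed_meet P \<epsilon> (\<lambda>a. a) xs" using xs by (intro signed_meet_cong) auto
    finally show ?thesis using f[OF S \<open>?E \<in> ?F S\<close>] by simp
  qed
  have ht: "free_HT_state P G f' f"
    unfolding free_HT_state_def
  proof (intro allI impI conjI ballI)
    fix S assume "maximal_compatible P G S"
    then have S: "S \<subseteq> G" "compatible P S" by (simp_all add: maximal_compatible_def)
    show "f (signed_meet (free_ops G) \<epsilon> (free_gen G) xs) = f' (signed_meet P \<epsilon> (\<lambda>a. a) xs)"
      if "distinct xs \<and> set xs = S" for xs \<epsilon>
      using atom[OF S] that by blast
    show "f (E \<union> E') = f E + f E'" if "E \<in> ?F S" "E' \<in> ?F S" "E \<inter> E' = {}" for E E'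
      using add[OF S that] .
  qed
  have nonneg: "0 \<le> f' (?s w (en S))" if S: "S \<subseteq> G" "compatible P S" for S w
  proof -
    obtain B where B: "S \<subseteq> B" "boolean_algebra_on P B" "normalized_measure P B f'"
      using ctx[OF S(2)] by blast
    then have "?s w (en S) \<in> B" using en[OF S(1)] by (intro signed_meet_closed) auto
    then show ?thesis using B(3) by (simp add: normalized_measure_def)
  qed
  have one: "g S (Pow G) = 1" if S: "S \<subseteq> G" "compatible P S" for S
  proof -
    obtain B where B: "normalized_measure P B f'" using ctx[OF S(2)] by blast
    have "g S (Pow G) = g {} (Pow G)" using S by (intro g_sub) auto
    also have "{w \<in> Pow {}. w \<in> Pow G} = {{}}" by auto
    then have "g {} (Pow G) = f' (bone P)"
      using en(2)[of "{}"] by (simp add: g_def signed_meet_def)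
    finally show ?thesis using B by (simp add: normalized_measure_def)
  qed
  have bounds: "0 \<le> f E \<and> f E \<le> 1" if "S \<subseteq> G" "compatible P S" "E \<in> ?F S" for S E
  proof -
    have "f E = g S E" using that by (rule f)
    moreover have "0 \<le> g S E" unfolding g_def using nonneg that by (intro sum_nonneg) auto
    moreover have "g S E \<le> g S (Pow G)"
      unfolding g_def using nonneg that finS by (intro sum_mono2) auto
    ultimately show ?thesis using one that by simp
  qed
  have "normalized_measure (free_HT_pba P G) C f"
    if "S \<subseteq> G" "compatible P S" "subalgebra_on (free_ops G) C (?F S)" for S C
  proof -
    have C: "C \<subseteq> ?F S" "Pow G \<in> C" using that(3) by (auto simp: subalgebra_on_def)
    have "f (Pow G) = 1" using f[OF that(1,2)] one[OF that(1,2)] C by auto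
    then show ?thesis
      using C bounds[OF that(1,2)] add[OF that(1,2)] by (auto simp: normalized_measure_def subset_iff)
  qed
  moreover have "f E \<in> {0..1}" if E: "E \<in> elems (free_HT_pba P G)" for E
  proof -
    obtain S C where "S \<subseteq> G" "compatible P S" "subalgebra_on (free_ops G) C (?F S)" "E \<in> C"
      using E by (auto simp: elems_def)
    then show ?thesis using bounds[of S E] by (auto simp: subalgebra_on_def)
  qed
  ultimately have "is_state (free_HT_pba P G) f"
    unfolding is_state_def free_HT_pba_simps by blast
  then have "is_ppt (free_HT_pba P G) f"
    using free_HT_pba_is_pba[OF P G] by (simp add: is_ppt_def)
  then show thesis using that ht by blast
qed

end

theory Submission
  imports Defs
begin

text \<open>
  A classical representation of either theory yields nonnegative weights \<open>p\<close> on the truth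
  assignments \<open>v \<subseteq> G\<close> (the measure of the atom \<open>v\<close> of the free algebra) whose marginal on every
  compatible set of generators is prescribed by the state of \<open>P\<close>. For (a), such weights form a
  measure on the free algebra. For (b), let \<open>\<Omega>\<close> be the set of assignments that have positive
  weight for some \<open>k \<in> K'\<close>. On each context such an assignment selects a nonzero atom, hence a
  two-valued homomorphism; by property (G), applied to pairs of contexts, these homomorphisms agree
  on intersections. So every element of \<open>P\<close> becomes a subset of \<open>\<Omega>\<close>, and distinct elements become
  distinct subsets because the states separate them.
\<close>

section \<open>Two-valued evaluation below an element\<close>

lemma bmeet_idem:
  assumes B: "boolean_algebra_on R B" and x: "x \<in> B"
  shows "bmeet R x x = x"
  using bool_alg(14)[OF B x x bool_alg(3)[OF B x]] bool_alg(6,8,9)[OF B x]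
    bool_alg(7)[OF B bool_alg(4)[OF B x x]] by simp

lemma bjoin_idem:
  assumes B: "boolean_algebra_on R B" and x: "x \<in> B"
  shows "bjoin R x x = x"
  using bool_alg(15)[OF B x x bool_alg(3)[OF B x]] bool_alg(7,8,9)[OF B x]
    bool_alg(6)[OF B bool_alg(5)[OF B x x]] by simp

lemma bmeet_bzero:
  assumes B: "boolean_algebra_on R B" and x: "x \<in> B"
  shows "bmeet R x (bzero R) = bzero R" "bmeet R (bzero R) x = bzero R"
proof -
  have "bmeet R x (bzero R) = bmeet R (bmeet R x x) (bcompl R x)"
    using bool_alg(12)[OF B x x bool_alg(3)[OF B x]] bool_alg(8)[OF B x] by simp
  then show "bmeet R x (bzero R) = bzero R" using bmeet_idem[OF B x] bool_alg(8)[OF B x] by simp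
  then show "bmeet R (bzero R) x = bzero R" using bool_alg(10)[OF B x bool_alg(1)[OF B]] by simp
qed

lemma normalized_measure_bzero:
  assumes B: "boolean_algebra_on R B" and "normalized_measure R B \<mu>"
  shows "\<mu> (bzero R) = 0"
proof -
  note z = bool_alg(1)[OF B]
  have "\<mu> (bjoin R (bzero R) (bzero R)) = \<mu> (bzero R) + \<mu> (bzero R)"
    using assms(2) bmeet_bzero[OF B z] z unfolding normalized_measure_def by blast
  then show ?thesis using bjoin_idem[OF B z] by simp
qed

text \<open>Unless \<open>a\<close> is zero, at most one truth value \<open>t\<close> satisfies \<open>evaluates R a x t\<close>.\<close>

definition evaluates :: "('a, 'm) boolean_ops_scheme \<Rightarrow> 'a \<Rightarrow> 'a \<Rightarrow> bool \<Rightarrow> bool" where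
  "evaluates R a x t \<longleftrightarrow> bmeet R a x = (if t then a else bzero R)"

lemma evaluates_iff:
  "evaluates R a x t \<Longrightarrow> a \<noteq> bzero R \<Longrightarrow> bmeet R a x = a \<longleftrightarrow> t"
  by (auto simp: evaluates_def)

context
  fixes R :: "('a, 'm) boolean_ops_scheme" and B and a
  assumes B: "boolean_algebra_on R B" and a: "a \<in> B"
begin

lemma evaluates_bzero: "evaluates R a (bzero R) False"
  using bmeet_bzero[OF B a] by (simp add: evaluates_def)

lemma evaluates_bone: "evaluates R a (bone R) True"
  using bool_alg(6)[OF B a] by (simp add: evaluates_def)

lemma evaluates_bcompl:
  assumes x: "x \<in> B" and t: "evaluates R a x t"
  shows "evaluates R a (bcompl R x) (\<not> t)"
proof -
  note c = bool_alg(3)[OF B x]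
  note ac = bool_alg(4)[OF B a c]
  \<comment> \<open>This equation settles the case \<open>t = True\<close>. The splitting of
    \<open>a\<close> along \<open>x\<close> and its complement, shown next, settles
    \<open>t = False\<close>.\<close>
  have "bmeet R (bmeet R a x) (bcompl R x) = bzero R"
    using bool_alg(12)[OF B a x c] bool_alg(8)[OF B x] bmeet_bzero[OF B a] by simp
  moreover have "bjoin R (bmeet R a x) (bmeet R a (bcompl R x)) = a"
    using bool_alg(14)[OF B a x c] bool_alg(9)[OF B x] bool_alg(6)[OF B a] by simp
  ultimately show ?thesis
    using t bool_alg(11)[OF B bool_alg(1)[OF B] ac] bool_alg(7)[OF B ac]
    by (cases t) (simp_all add: evaluates_def)
qed

lemma evaluates_bmeet:
  assumes "x \<in> B" "y \<in> B" "evaluates R a x s" "evaluates R a y t"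
  shows "evaluates R a (bmeet R x y) (s \<and> t)"
  using assms bool_alg(12)[OF B a assms(1,2)] bmeet_bzero[OF B assms(2)]
  by (cases s; cases t) (simp_all add: evaluates_def)

lemma evaluates_bjoin:
  assumes "x \<in> B" "y \<in> B" "evaluates R a x s" "evaluates R a y t"
  shows "evaluates R a (bjoin R x y) (s \<or> t)"
  using assms bool_alg(14)[OF B a assms(1,2)] bjoin_idem[OF B a] bool_alg(7)[OF B a]
    bjoin_idem[OF B bool_alg(1)[OF B]] bool_alg(11)[OF B a bool_alg(1)[OF B]]
  by (cases s; cases t) (simp_all add: evaluates_def)

text \<open>If \<open>a\<close> gives each \<open>h b\<close> the truth value
  \<open>b \<in> v\<close>, then the literal of \<open>b\<close> is true below \<open>a\<close>
  exactly when \<open>v\<close> agrees with \<open>\<epsilon>\<close> at \<open>b\<close>. A signed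
  meet is the conjunction of its literals.\<close>

lemma evaluates_signed_meet:
  assumes "h ` set xs \<subseteq> B" "\<And>b. b \<in> set xs \<Longrightarrow> evaluates R a (h b) (b \<in> v)"
  shows "evaluates R a (signed_meet R \<epsilon> h xs) (\<forall>b\<in>set xs. (b \<in> v) = \<epsilon> b)"
  using assms
proof (induction xs)
  case Nil
  then show ?case using evaluates_bone by (simp add: signed_meet_def)
next
  case (Cons b xs)
  let ?l = "if \<epsilon> b then h b else bcompl R (h b)"
  have b: "h b \<in> B" "evaluates R a (h b) (b \<in> v)" using Cons.prems by auto
  then have "?l \<in> B" "evaluates R a ?l ((b \<in> v) = \<epsilon> b)"
    using bool_alg(3)[OF B] evaluates_bcompl by auto
  moreover have "signed_meet R \<epsilon> h xs \<in> B"
    using Cons.prems by (intro signed_meet_closed[OF B]) auto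
  ultimately have "evaluates R a (bmeet R ?l (signed_meet R \<epsilon> h xs))
      ((b \<in> v) = \<epsilon> b \<and> (\<forall>b\<in>set xs. (b \<in> v) = \<epsilon> b))"
    using Cons by (intro evaluates_bmeet) auto
  then show ?case by (simp add: signed_meet_Cons)
qed

end

text \<open>Truth values propagate through the Boolean operations, so two elements that agree on
  \<open>T\<close> agree on all that \<open>T\<close> generates. The carriers \<open>B\<close> and
  \<open>C\<close> may differ, which allows two contexts to be compared on their intersection. The
  value \<open>t\<close> is built along with \<open>x\<close>.\<close>

lemma evaluates_generated:
  assumes B: "boolean_algebra_on R B" "a \<in> B" and C: "boolean_algebra_on R C" "c \<in> C"
    and T: "T \<subseteq> B \<inter> C" "\<And>b. b \<in> T \<Longrightarrow> evaluates R a b (b \<in> v) \<and> evaluates R c b (b \<in> v)"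
    and x: "x \<in> generated R T"
  shows "\<exists>t. evaluates R a x t \<and> evaluates R c x t"
proof -
  have gen: "y \<in> B" "y \<in> C" if "y \<in> generated R T" for y
    using that T(1) generated_subset[OF B(1), of T] generated_subset[OF C(1), of T] by auto
  from x show ?thesis
  proof induction
    case zero
    then show ?case using evaluates_bzero[OF B] evaluates_bzero[OF C] by blast
  next
    case one
    then show ?case using evaluates_bone[OF B] evaluates_bone[OF C] by blast
  next
    case (compl x)
    then show ?case
      using gen[OF compl(1)] evaluates_bcompl[OF B] evaluates_bcompl[OF C] by blast
  next
    case (meet x y)
    then show ?case
      using gen[OF meet(1)] gen[OF meet(2)] evaluates_bmeet[OF B] evaluates_bmeet[OF C] by blast
  next
    case (join x y)
    then show ?case
      using gen[OF join(1)] gen[OF join(2)] evaluates_bjoin[OF B] evaluates_bjoin[OF C] by blast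
  qed (use T(2) in blast)
qed

text \<open>The literal of \<open>b\<close> is a factor of the signed meet. Moved to the end, it
  meets \<open>h b\<close> either in \<open>h b\<close> itself or in zero. The signed meet may be
  zero; both truth values are then correct.\<close>

lemma evaluates_signed_meet_generator:
  assumes B: "boolean_algebra_on R B" and xs: "h ` set xs \<subseteq> B" "b \<in> set xs"
  shows "evaluates R (signed_meet R (\<lambda>a. a \<in> v) h xs) (h b) (b \<in> v)"
proof -
  obtain ys zs where l: "xs = ys @ b # zs" using xs(2) by (meson split_list)
  let ?m = "signed_meet R (\<lambda>a. a \<in> v) h (ys @ zs)"
  let ?l = "if b \<in> v then h b else bcompl R (h b)"
  have b: "h b \<in> B" using xs by auto
  have c: "bcompl R (h b) \<in> B" "?l \<in> B" using b bool_alg(3)[OF B] by auto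
  have m: "?m \<in> B" using xs by (intro signed_meet_closed[OF B]) (auto simp: l)
  have s: "signed_meet R (\<lambda>a. a \<in> v) h xs = bmeet R ?m ?l"
    using signed_meet_move[OF B, of h ys b zs] xs bool_alg(10)[OF B m c(2)]
    by (simp add: l signed_meet_Cons)
  have "bmeet R ?l (h b) = (if b \<in> v then h b else bzero R)"
    using bmeet_idem[OF B b] bool_alg(8)[OF B b] bool_alg(10)[OF B b c(1)] by simp
  then show ?thesis
    unfolding evaluates_def s using bool_alg(12)[OF B m c(2) b] bmeet_bzero[OF B m] by simp
qed

section \<open>Measures as sums over truth assignments\<close>

text \<open>The signed meets over all \<open>w\<close> form a partition of unity, which cuts
  \<open>m\<close> into disjoint pieces. In the induction, the assignments \<open>w\<close> and
  \<open>insert a w\<close> are paired, and \<open>measure_split\<close> merges their two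
  pieces.\<close>

lemma sum_measure_signed_meet:
  assumes B: "boolean_algebra_on R B" and \<mu>: "normalized_measure R B \<mu>"
    and "h ` set xs \<subseteq> B" "distinct xs" and m: "m \<in> B"
  shows "(\<Sum>w\<in>Pow (set xs). \<mu> (bmeet R (signed_meet R (\<lambda>a. a \<in> w) h xs) m)) = \<mu> m"
  using assms(3,4)
proof (induction xs)
  case Nil
  then show ?case
    using bool_alg(6,10)[OF B m] bool_alg(2)[OF B] by (simp add: signed_meet_def)
next
  case (Cons a xs)
  let ?s = "\<lambda>w. signed_meet R (\<lambda>a. a \<in> w) h xs"
  let ?m = "\<lambda>w. \<mu> (bmeet R (signed_meet R (\<lambda>a. a \<in> w) h (a # xs)) m)"
  have a: "a \<notin> set xs" "h a \<in> B" using Cons.prems by auto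
  note c = bool_alg(3)[OF B a(2)]
  have inj: "inj_on (insert a) (Pow (set xs))" using a by (auto intro!: inj_onI)
  have "sum ?m (Pow (set (a # xs))) = sum ?m (Pow (set xs)) + sum ?m (insert a ` Pow (set xs))"
    using a by (simp only: list.set Pow_insert, subst sum.union_disjoint) auto
  also have "\<dots> = (\<Sum>w\<in>Pow (set xs). ?m w + ?m (insert a w))"
    by (subst sum.reindex[OF inj]) (simp only: comp_def sum.distrib)
  also have "\<dots> = (\<Sum>w\<in>Pow (set xs). \<mu> (bmeet R (?s w) m))"
  proof (rule sum.cong)
    fix w assume "w \<in> Pow (set xs)"
    then have w: "a \<notin> w" using a by auto
    have s: "?s w \<in> B" using Cons.prems by (intro signed_meet_closed[OF B]) auto
    have "?s (insert a w) = ?s w" using a by (intro signed_meet_cong) auto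
    then have "?m w = \<mu> (bmeet R (bcompl R (h a)) (bmeet R (?s w) m))"
      "?m (insert a w) = \<mu> (bmeet R (h a) (bmeet R (?s w) m))"
      using w bool_alg(12)[OF B c s m] bool_alg(12)[OF B a(2) s m] by (simp_all add: signed_meet_Cons)
    then show "?m w + ?m (insert a w) = \<mu> (bmeet R (?s w) m)"
      using measure_split[OF B \<mu> a(2) bool_alg(4)[OF B s m]] by simp
  qed simp
  also have "\<dots> = \<mu> m" using Cons.IH Cons.prems by simp
  finally show ?case .
qed

text \<open>Every piece of the partition lies below \<open>m\<close> or is disjoint from it, as
  \<open>Q\<close> tells, so only the former contribute. A piece equal to zero has measure 0 and is
  harmless whichever value \<open>Q\<close> takes there.\<close>

lemma measure_eq_sum_signed_meet:
  assumes B: "boolean_algebra_on R B" and \<mu>: "normalized_measure R B \<mu>"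
    and xs: "h ` set xs \<subseteq> B" "distinct xs" and m: "m \<in> B"
    and Q: "\<And>w. w \<subseteq> set xs \<Longrightarrow> evaluates R (signed_meet R (\<lambda>a. a \<in> w) h xs) m (Q w)"
  shows "\<mu> m = (\<Sum>w\<in>{w \<in> Pow (set xs). Q w}. \<mu> (signed_meet R (\<lambda>a. a \<in> w) h xs))"
proof -
  let ?s = "\<lambda>w. signed_meet R (\<lambda>a. a \<in> w) h xs"
  have "\<mu> m = (\<Sum>w\<in>Pow (set xs). \<mu> (bmeet R (?s w) m))"
    using sum_measure_signed_meet[OF B \<mu> xs m] by simp
  also have "\<dots> = (\<Sum>w\<in>Pow (set xs). if Q w then \<mu> (?s w) else 0)"
    using Q normalized_measure_bzero[OF B \<mu>] by (intro sum.cong) (auto simp: evaluates_def)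
  also have "\<dots> = (\<Sum>w\<in>{w \<in> Pow (set xs). Q w}. \<mu> (?s w))"
    by (subst sum.inter_filter) auto
  finally show ?thesis .
qed

section \<open>Weights from a classical representation, and representations by sets of
  points\<close>

lemma signed_meet_hom:
  assumes C: "boolean_algebra_on Q C" "h ` set xs \<subseteq> C"
    and "\<phi> (bone Q) = bone R" "\<And>x. x \<in> C \<Longrightarrow> \<phi> (bcompl Q x) = bcompl R (\<phi> x)"
    and "\<And>x y. x \<in> C \<Longrightarrow> y \<in> C \<Longrightarrow> \<phi> (bmeet Q x y) = bmeet R (\<phi> x) (\<phi> y)"
  shows "\<phi> (signed_meet Q \<epsilon> h xs) = signed_meet R \<epsilon> (\<lambda>a. \<phi> (h a)) xs"
  using C(2)
proof (induction xs)
  case (Cons a xs)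
  then have "h a \<in> C" "signed_meet Q \<epsilon> h xs \<in> C"
    by (auto intro: signed_meet_closed[OF C(1)])
  then show ?case using Cons assms(4,5) bool_alg(3)[OF C(1)] by (simp add: signed_meet_Cons)
qed (simp add: signed_meet_def assms)

text \<open>The weight of \<open>v\<close> is the measure of the atom that \<open>v\<close> cuts out
  in the representing algebra, and a signed meet over \<open>xs\<close> is composed of the atoms of
  the assignments matching \<open>\<epsilon>\<close> on \<open>xs\<close>. The labelling
  \<open>h\<close> is the identity when \<open>Q\<close> is the given theory and
  \<open>free_gen G\<close> when \<open>Q\<close> is the free one.\<close>

lemma classical_representation_weights:
  assumes Q: "is_pba Q" and adm: "admits_classical_representation Q g"
    and G: "finite G" "h ` G \<subseteq> elems Q"
  obtains p :: "'a set \<Rightarrow> real" where "\<And>v. 0 \<le> p v"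
    "\<And>C xs \<epsilon>. C \<in> algs Q \<Longrightarrow> set xs \<subseteq> G \<Longrightarrow> h ` set xs \<subseteq> C \<Longrightarrow>
       g (signed_meet Q \<epsilon> h xs) = sum p {v \<in> Pow G. \<forall>a\<in>set xs. (a \<in> v) = \<epsilon> a}"
proof -
  obtain R :: "nat boolean_ops" and B \<mu> \<phi> where "classical_representation Q g R B \<mu> \<phi>"
    using adm unfolding admits_classical_representation_def by blast
  note rep = this[unfolded classical_representation_def]
  have B: "boolean_algebra_on R B" and \<mu>: "normalized_measure R B \<mu>"
    and \<phi>: "\<phi> ` elems Q \<subseteq> B" and \<mu>_eq: "\<forall>C\<in>algs Q. \<forall>x\<in>C. \<mu> (\<phi> x) = g x"
    using rep by - (elim conjE, assumption)+
  note \<phi>_hom = rep[THEN conjunct2, THEN conjunct2, THEN conjunct2, THEN conjunct2, THEN conjunct1]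
  obtain gs where gs: "set gs = G" "distinct gs" using finite_distinct_list[OF G(1)] by blast
  define k where "k a = \<phi> (h a)" for a
  have k: "k ` G \<subseteq> B" using \<phi> G by (auto simp: k_def)
  \<comment> \<open>The generators in \<open>G\<close> need not be compatible in \<open>Q\<close>,
    so their common meet is formed in \<open>R\<close>, after applying
    \<open>\<phi>\<close>.\<close>
  define p where "p v = \<mu> (signed_meet R (\<lambda>a. a \<in> v) k gs)" for v
  have s: "signed_meet R \<epsilon> k xs \<in> B" if "set xs \<subseteq> G" for \<epsilon> xs
    using that k by (intro signed_meet_closed[OF B]) auto
  show thesis
  proof
    show "0 \<le> p v" for v
      using s[of gs] gs \<mu> by (simp add: p_def normalized_measure_def)
    fix C xs \<epsilon>
    assume C: "C \<in> algs Q" "set xs \<subseteq> G" "h ` set xs \<subseteq> C"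
    have ba: "boolean_algebra_on Q C" using Q C(1) by (simp add: is_pba_def)
    have k_xs: "k ` set xs \<subseteq> B" using k C(2) by blast
    have hom: "\<phi> (signed_meet Q \<epsilon> h xs) = signed_meet R \<epsilon> k xs"
      unfolding k_def using bspec[OF \<phi>_hom C(1)]
      by (intro signed_meet_hom[OF ba C(3)]) simp_all
    have "g (signed_meet Q \<epsilon> h xs) = \<mu> (signed_meet R \<epsilon> k xs)"
      using \<mu>_eq C(1) signed_meet_closed[OF ba C(3)] unfolding hom[symmetric] by simp
    also have "\<dots> = sum p {v \<in> Pow (set gs). \<forall>a\<in>set xs. (a \<in> v) = \<epsilon> a}"
      unfolding p_def
    proof (rule measure_eq_sum_signed_meet[OF B \<mu>])
      fix v
      let ?a = "signed_meet R (\<lambda>a. a \<in> v) k gs"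
      have "evaluates R ?a (k b) (b \<in> v)" if "b \<in> set xs" for b
        using that C(2) k gs(1) by (intro evaluates_signed_meet_generator[OF B]) auto
      then show "evaluates R ?a (signed_meet R \<epsilon> k xs) (\<forall>a\<in>set xs. (a \<in> v) = \<epsilon> a)"
        using s[of gs] gs k_xs by (intro evaluates_signed_meet[OF B]) auto
    qed (use gs k s C(2) in auto)
    finally show "g (signed_meet Q \<epsilon> h xs) = sum p {v \<in> Pow G. \<forall>a\<in>set xs. (a \<in> v) = \<epsilon> a}"
      by (simp add: gs)
  qed
qed

text \<open>The subsets of \<open>\<Omega>\<close> with point weights \<open>p\<close> form a
  measure algebra. The representing algebra is the field of sets generated by the image of
  \<open>\<phi>\<close>, because a classical representation has to be generated by the embedded
  elements.\<close>

lemma admits_classical_representation_setI: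
  assumes Q: "is_pba Q" and \<Omega>: "finite \<Omega>" and inj: "inj_on \<phi> (elems Q)"
    and sub: "\<And>x. x \<in> elems Q \<Longrightarrow> \<phi> x \<subseteq> \<Omega>"
    and c: "\<phi> (bzero Q) = {}" "\<phi> (bone Q) = \<Omega>"
    and hom: "\<And>C x. C \<in> algs Q \<Longrightarrow> x \<in> C \<Longrightarrow> \<phi> (bcompl Q x) = \<Omega> - \<phi> x"
      "\<And>C x y. C \<in> algs Q \<Longrightarrow> x \<in> C \<Longrightarrow> y \<in> C \<Longrightarrow> \<phi> (bmeet Q x y) = \<phi> x \<inter> \<phi> y"
      "\<And>C x y. C \<in> algs Q \<Longrightarrow> x \<in> C \<Longrightarrow> y \<in> C \<Longrightarrow> \<phi> (bjoin Q x y) = \<phi> x \<union> \<phi> y"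
    and p: "\<And>v. v \<in> \<Omega> \<Longrightarrow> 0 \<le> p v" "sum p \<Omega> = 1"
    and g: "\<And>x. x \<in> elems Q \<Longrightarrow> g x = sum p (\<phi> x)"
  shows "admits_classical_representation Q g"
proof -
  define R where "R = \<lparr>bmeet = (\<inter>), bjoin = (\<union>), bcompl = (\<lambda>E. \<Omega> - E), bzero = {}, bone = \<Omega>\<rparr>"
  have R: "bmeet R = (\<inter>)" "bjoin R = (\<union>)" "bcompl R = (\<lambda>E. \<Omega> - E)" "bzero R = {}" "bone R = \<Omega>"
    by (simp_all add: R_def)
  let ?B = "generated R (\<phi> ` elems Q)"
  have B: "E \<subseteq> \<Omega>" if "E \<in> ?B" for E
    using that by induction (use sub in \<open>auto simp: R\<close>)
  have closed: "{} \<in> ?B" "\<Omega> \<in> ?B" "\<And>E. E \<in> ?B \<Longrightarrow> \<Omega> - E \<in> ?B"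
    "\<And>E F. E \<in> ?B \<Longrightarrow> F \<in> ?B \<Longrightarrow> E \<inter> F \<in> ?B" "\<And>E F. E \<in> ?B \<Longrightarrow> F \<in> ?B \<Longrightarrow> E \<union> F \<in> ?B"
    using generated.intros(2-6)[where R = R and S = "\<phi> ` elems Q"] unfolding R by blast+
  have "boolean_algebra_on R ?B"
    unfolding boolean_algebra_on_def
    using B closed unfolding R by (intro conjI ballI) blast+
  moreover have "normalized_measure R ?B (sum p)"
    unfolding normalized_measure_def unfolding R
  proof (intro conjI ballI impI)
    show "0 \<le> sum p E" if "E \<in> ?B" for E using B[OF that] p(1) by (auto intro!: sum_nonneg)
    show "sum p (E \<union> F) = sum p E + sum p F" if "E \<in> ?B" "F \<in> ?B" "E \<inter> F = {}" for E F
      using that B \<Omega> by (meson finite_subset sum.union_disjoint)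
  qed (fact p(2))
  moreover have "\<phi> ` elems Q \<subseteq> ?B" by (auto intro: generated.base)
  moreover have "sum p (\<phi> x) = g x" if "C \<in> algs Q" "x \<in> C" for C x
    using that by (intro g[symmetric]) (auto simp: elems_def)
  ultimately have "classical_representation Q g R ?B (sum p) \<phi>"
    unfolding classical_representation_def using inj c hom by (auto simp: R)
  then show ?thesis by (rule admits_classical_representationI[OF Q])
qed

section \<open>From the theory on the generators to the free theory\<close>

lemma signed_meet_free_ops:
  "signed_meet (free_ops G) \<epsilon> (free_gen G) xs = {v \<in> Pow G. \<forall>a\<in>set xs. (a \<in> v) = \<epsilon> a}"
  by (induction xs) (auto simp: signed_meet_Cons free_gen_def, auto simp: signed_meet_def)

lemma signed_meet_free_HT_pba:
  "signed_meet (free_HT_pba P G) = signed_meet (free_ops G)"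
  by (simp add: signed_meet_def fun_eq_iff cong: if_cong)

lemma generated_free_in_algs:
  assumes "S \<subseteq> G" "compatible P S"
  shows "generated (free_ops G) (free_gen G ` S) \<in> algs (free_HT_pba P G)"
proof -
  have "subalgebra_on (free_ops G) (generated (free_ops G) (free_gen G ` S))
      (generated (free_ops G) (free_gen G ` S))"
    unfolding subalgebra_on_def by (blast intro: generated.intros)
  then show ?thesis using assms unfolding free_HT_pba_simps by blast
qed

lemma compatible_singleton:
  assumes "is_pba P" "a \<in> elems P"
  shows "compatible P {a}"
  using assms context_exists unfolding elems_def compatible_def by (metis UnionE empty_subsetI insert_subset subsetD)

text \<open>\<open>free_HT_state\<close> prescribes \<open>g\<close> on the atoms of the algebra
  freely generated by \<open>S\<close> and makes it additive there. As \<open>sum p\<close> has the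
  same values on the atoms, the two agree on every disjoint union of atoms.\<close>

lemma free_HT_state_eq_sum:
  assumes P: "is_pba P" and G: "G \<subseteq> elems P" and ht: "free_HT_state P G g' g"
    and S: "maximal_compatible P G S"
    and p: "\<And>xs \<epsilon>. set xs = S \<Longrightarrow>
      g' (signed_meet P \<epsilon> (\<lambda>a. a) xs) = sum p {v \<in> Pow G. \<forall>a\<in>set xs. (a \<in> v) = \<epsilon> a}"
    and E: "E \<in> generated (free_ops G) (free_gen G ` S)"
  shows "g E = sum p E"
proof -
  let ?F = "generated (free_ops G) (free_gen G ` S)"
  have SG: "S \<subseteq> G" "compatible P S" using S by (auto simp: maximal_compatible_def)
  have fin: "finite G" using P G by (meson is_pba_def finite_subset)
  then have finS: "finite S" using SG by (meson finite_subset)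
  obtain xs where xs: "set xs = S" "distinct xs" using finite_distinct_list[OF finS] by blast
  have ba: "boolean_algebra_on (free_HT_pba P G) ?F"
    using free_HT_pba_is_pba[OF P G] generated_free_in_algs[OF SG] by (simp only: is_pba_def)
  \<comment> \<open>For \<open>w \<subseteq> S\<close> this cylinder of all assignments with trace
    \<open>w\<close> on \<open>S\<close> is an atom of \<open>?F\<close>.\<close>
  define A where "A w = {v \<in> Pow G. v \<inter> S = w}" for w
  have A: "A w = signed_meet (free_ops G) (\<lambda>a. a \<in> w) (free_gen G) xs" if "w \<subseteq> S" for w
    using that xs by (auto simp: A_def signed_meet_free_ops)
  have AF: "A w \<in> ?F" if "w \<subseteq> S" for w
    unfolding A[OF that] signed_meet_free_HT_pba[of P, symmetric] using xs
    by (intro signed_meet_closed[OF ba]) (auto intro: generated.base)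
  have add: "g (X \<union> Y) = g X + g Y" if "X \<in> ?F" "Y \<in> ?F" "X \<inter> Y = {}" for X Y
    using ht S that unfolding free_HT_state_def by blast
  have gA: "g (A w) = sum p (A w)" if "w \<subseteq> S" for w
  proof -
    have "g (A w) = g' (signed_meet P (\<lambda>a. a \<in> w) (\<lambda>a. a) xs)"
      unfolding A[OF that] using ht S xs unfolding free_HT_state_def by blast
    then show ?thesis using p[OF xs(1)] A[OF that] by (simp add: signed_meet_free_ops)
  qed
  \<comment> \<open>Membership in \<open>?F\<close> is carried through the induction because
    \<open>g\<close> is known to be additive only there.\<close>
  have union: "(\<Union>w\<in>W. A w) \<in> ?F \<and> g (\<Union>w\<in>W. A w) = (\<Sum>w\<in>W. g (A w))" if "finite W" "W \<subseteq> Pow S" for W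
    using that
  proof (induction W)
    case empty
    have "{} \<in> ?F" using generated.zero[of "free_ops G"] by simp
    \<comment> \<open>Additivity for two empty sets forces \<open>g {} = 0\<close>.\<close>
    then show ?case using add[of "{}" "{}"] by simp
  next
    case (insert w W)
    moreover have "A w \<inter> (\<Union>w\<in>W. A w) = {}" using insert.hyps by (auto simp: A_def)
    moreover have "A w \<union> (\<Union>w\<in>W. A w) \<in> ?F"
      using generated.join[of "A w" "free_ops G"] insert AF by simp
    ultimately show ?case using add[of "A w" "\<Union>w\<in>W. A w"] AF by simp
  qed
  let ?W = "{w \<in> Pow S. w \<in> E}"
  have EG: "E \<subseteq> Pow G" using E generated_free_subset by blast
  have iff: "v \<in> E \<longleftrightarrow> v \<inter> S \<in> E" if "v \<subseteq> G" for v using generated_free_iff[OF E SG(1) that] .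
  then have EW: "E = (\<Union>w\<in>?W. A w)" using EG by (auto simp: A_def)
  have "finite ?W" using finS by simp
  then have "g E = (\<Sum>w\<in>?W. g (A w))" using union[of ?W] EW by auto
  also have "\<dots> = (\<Sum>w\<in>?W. sum p (A w))" using gA by (intro sum.cong) auto
  also have "\<dots> = (\<Sum>w\<in>?W. sum p {v \<in> E. v \<inter> S = w})"
    using EG iff by (intro sum.cong refl) (auto simp: A_def)
  \<comment> \<open>The sets summed over are the fibres of \<open>\<lambda>v. v \<inter> S\<close>
    on \<open>E\<close>.\<close>
  also have "\<dots> = sum p E"
    using iff EG \<open>finite ?W\<close> fin by (intro sum.group) (auto intro: finite_subset[of E "Pow G"])
  finally show ?thesis .
qed

text \<open>The free theory already consists of sets of assignments, so the identity embeds it and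
  the weights obtained from the representation of \<open>P\<close> provide the measure.\<close>

lemma free_HT_admits_classical_representation:
  assumes ppt: "is_ppt P g'" and G: "G \<subseteq> elems P" and ht: "free_HT_state P G g' g"
    and adm: "admits_classical_representation P g'"
  shows "admits_classical_representation (free_HT_pba P G) g"
proof -
  let ?F = "\<lambda>S. generated (free_ops G) (free_gen G ` S)"
  have P: "is_pba P" and st: "is_state P g'" using ppt by (auto simp: is_ppt_def)
  have fin: "finite G" using P G by (meson is_pba_def finite_subset)
  have "(\<lambda>a. a) ` G \<subseteq> elems P" using G by simp
  from classical_representation_weights[OF P adm fin this]
  obtain p :: "'a set \<Rightarrow> real" where p: "\<And>v. 0 \<le> p v"
    "\<And>C xs \<epsilon>. C \<in> algs P \<Longrightarrow> set xs \<subseteq> G \<Longrightarrow> (\<lambda>a. a) ` set xs \<subseteq> C \<Longrightarrow>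
       g' (signed_meet P \<epsilon> (\<lambda>a. a) xs) = sum p {v \<in> Pow G. \<forall>a\<in>set xs. (a \<in> v) = \<epsilon> a}"
    by blast
  have gE: "g E = sum p E" if E: "E \<in> ?F S" and S: "S \<subseteq> G" "compatible P S" for E S
  proof -
    \<comment> \<open>\<open>S\<close> is enlarged because \<open>free_HT_state\<close> speaks of
      maximal compatible sets only.\<close>
    obtain T where T: "maximal_compatible P G T" "S \<subseteq> T"
      using maximal_compatible_exists[OF fin S] .
    then obtain B where B: "B \<in> algs P" "T \<subseteq> B" "T \<subseteq> G"
      by (auto simp: maximal_compatible_def compatible_def is_context_def)
    have "E \<in> ?F T" using E generated_mono[of "free_gen G ` S" "free_gen G ` T"] T(2) by blast
    moreover have "g' (signed_meet P \<epsilon> (\<lambda>a. a) xs) = sum p {v \<in> Pow G. \<forall>a\<in>set xs. (a \<in> v) = \<epsilon> a}"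
      if "set xs = T" for xs \<epsilon>
      using B that by (intro p(2)) auto
    ultimately show ?thesis using free_HT_state_eq_sum[OF P G ht T(1)] by blast
  qed
  have el: "\<exists>S\<subseteq>G. compatible P S \<and> E \<in> ?F S" if "E \<in> elems (free_HT_pba P G)" for E
    using that by (auto simp: elems_def subalgebra_on_def)
  show ?thesis
  proof (rule admits_classical_representation_setI[where \<phi> = "\<lambda>E. E" and \<Omega> = "Pow G" and p = p])
    show "E \<subseteq> Pow G" if "E \<in> elems (free_HT_pba P G)" for E
      using el[OF that] generated_free_subset by blast
    show "g E = sum p E" if "E \<in> elems (free_HT_pba P G)" for E
      using el[OF that] gE by blast
    obtain B where B: "B \<in> algs P" using P by (auto simp: is_pba_def)
    \<comment> \<open>The empty signed meet is the unit, and every assignment satisfies its empty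
      condition.\<close>
    have "g' (bone P) = sum p (Pow G)" using p(2)[OF B, of "[]"] by (simp add: signed_meet_def Pow_def)
    then show "sum p (Pow G) = 1" using st B by (simp add: is_state_def normalized_measure_def)
  qed (use free_HT_pba_is_pba[OF P G] fin p(1) in auto)
qed

section \<open>From the free theories to the theory on the generators\<close>

text \<open>Some subset of \<open>G\<close> generates \<open>B\<close>, hence so does the largest
  candidate \<open>G \<inter> B\<close>. A context containing \<open>G \<inter> B\<close> then
  contains \<open>B\<close> and equals it, so no compatible set of generators is larger.\<close>

lemma context_generators:
  assumes P: "is_pba P" and G: "generates_pba P G" and B: "is_context P B"
  shows "generated P (G \<inter> B) = B" "maximal_compatible P G (G \<inter> B)"
proof -
  have ba: "boolean_algebra_on P C" if "is_context P C" for C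
    using P that by (simp add: is_pba_def is_context_def)
  obtain S where S: "S \<subseteq> G" "generated P S = B" using G B by (auto simp: generates_pba_def)
  have "S \<subseteq> B" using S(2) by (auto intro: generated.base)
  then have "generated P S \<subseteq> generated P (G \<inter> B)" using S(1) by (intro generated_mono) auto
  then show gen: "generated P (G \<inter> B) = B"
    using S(2) generated_subset[OF ba[OF B], of "G \<inter> B"] by auto
  show "maximal_compatible P G (G \<inter> B)"
    unfolding maximal_compatible_def
  proof (intro conjI allI impI)
    show "compatible P (G \<inter> B)" using B by (auto simp: compatible_def)
    fix T assume T: "G \<inter> B \<subseteq> T \<and> T \<subseteq> G \<and> compatible P T"
    then obtain C where C: "is_context P C" "T \<subseteq> C" by (auto simp: compatible_def)
    then have "B \<subseteq> C" using gen generated_subset[OF ba[OF C(1)], of "G \<inter> B"] T by auto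
    then have "C = B" using B C(1) by (auto simp: is_context_def)
    then show "T = G \<inter> B" using T C(2) by auto
  qed simp
qed

text \<open>Property (G) is used with \<open>r = 2\<close>. Where it is silent, the intersection is
  \<open>{bzero P, bone P}\<close>, whose elements are generated by any set.\<close>

lemma property_G_inter:
  assumes P: "is_pba P" and G: "generates_pba P G" "property_G P G"
    and B: "is_context P B" and C: "is_context P C" and x: "x \<in> B" "x \<in> C"
  shows "x \<in> generated P (G \<inter> B \<inter> (G \<inter> C))"
proof (cases "B \<inter> C = {bzero P, bone P}")
  case True
  then have "x = bzero P \<or> x = bone P" using x by blast
  then show ?thesis using generated.zero generated.one by metis
next
  case False
  define Bs where "Bs l = (if l = 0 then B else C)" for l :: nat
  define Gs where "Gs l = G \<inter> Bs l" for l
  have two: "{..<2} = {0, Suc 0}" by auto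
  have "is_context P (Bs l) \<and> maximal_compatible P G (Gs l) \<and> generated P (Gs l) = Bs l" for l
    unfolding Gs_def using B C context_generators[OF P G(1)] by (simp add: Bs_def)
  moreover have "(\<Inter>l<2. Bs l) = B \<inter> C" "(\<Inter>l<2. Gs l) = G \<inter> B \<inter> (G \<inter> C)"
    by (auto simp: two Bs_def Gs_def)
  moreover have "(1::nat) \<le> 2" by simp
  ultimately have "generated P (G \<inter> B \<inter> (G \<inter> C)) = B \<inter> C"
    using G(2) False unfolding property_G_def by metis
  then show ?thesis using x by auto
qed

text \<open>One embedding \<open>\<phi>\<close> serves all states in \<open>K\<close>. Since each
  \<open>g i x\<close> is the weight of \<open>\<phi> x\<close>, equal images would give equal
  values under every state, contrary to \<open>sep\<close>.\<close>

lemma admits_classical_representation_of_weights: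
  fixes p :: "'k \<Rightarrow> 'a set \<Rightarrow> real"
  assumes P: "is_pba P" and st: "\<And>k. k \<in> K \<Longrightarrow> is_state P (g k)"
    and G: "generates_pba P G" "property_G P G"
    and sep: "\<And>x y. x \<in> elems P \<Longrightarrow> y \<in> elems P \<Longrightarrow> x \<noteq> y \<Longrightarrow> \<exists>k\<in>K. g k x \<noteq> g k y"
    and p0: "\<And>k v. k \<in> K \<Longrightarrow> 0 \<le> p k v"
    and p: "\<And>k B xs \<epsilon>. k \<in> K \<Longrightarrow> is_context P B \<Longrightarrow> distinct xs \<Longrightarrow> set xs = G \<inter> B \<Longrightarrow>
      g k (signed_meet P \<epsilon> (\<lambda>a. a) xs) = sum (p k) {v \<in> Pow G. \<forall>a\<in>set xs. (a \<in> v) = \<epsilon> a}"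
    and k: "k \<in> K"
  shows "admits_classical_representation P (g k)"
proof -
  have fin: "finite G" using P G(1) by (meson is_pba_def generates_pba_def finite_subset)
  define en where "en B = (SOME xs. distinct xs \<and> set xs = G \<inter> B)" for B
  have en: "distinct (en B)" "set (en B) = G \<inter> B" for B
    using someI_ex[OF finite_distinct_list[of "G \<inter> B"]] fin by (auto simp: en_def conj_commute)
  define atom where "atom B v = signed_meet P (\<lambda>a. a \<in> v) (\<lambda>a. a) (en B)" for B v
  have ba: "boolean_algebra_on P B" and nm: "i \<in> K \<Longrightarrow> normalized_measure P B (g i)"
    if "is_context P B" for B i
    using P st that by (auto simp: is_pba_def is_context_def is_state_def)
  have atom_in: "atom B v \<in> B" if "is_context P B" for B v
    unfolding atom_def using en by (intro signed_meet_closed[OF ba[OF that]]) auto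
  have atom_cong: "atom B v = atom B (v \<inter> (G \<inter> B))" for B v
    unfolding atom_def using en by (intro signed_meet_cong) auto
  have g_atom: "g i (atom B w) = sum (p i) {v \<in> Pow G. \<forall>a\<in>G \<inter> B. (a \<in> v) = (a \<in> w)}"
    if "i \<in> K" "is_context P B" for i B w
    using p[OF that en] en by (simp add: atom_def)
  have atom_gen: "evaluates P (atom B v) b (b \<in> v)" if "is_context P B" "b \<in> G \<inter> B" for B b v
    using evaluates_signed_meet_generator[OF ba[OF that(1)], of "\<lambda>a. a" "en B"] en that(2)
    by (auto simp: atom_def)
  \<comment> \<open>A generator common to both contexts gets the value \<open>b \<in> v\<close> from
    either atom, and by property (G) such generators produce all of the intersection.\<close>
  have agree: "\<exists>t. evaluates P (atom B v) x t \<and> evaluates P (atom C v) x t"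
    if "is_context P B" "is_context P C" "x \<in> B" "x \<in> C" for B C x v
    using that atom_gen
    by (intro evaluates_generated[OF ba[OF that(1)] atom_in[OF that(1)] ba[OF that(2)] atom_in[OF that(2)],
          where T = "G \<inter> B \<inter> (G \<inter> C)" and v = v] property_G_inter[OF P G]) auto
  \<comment> \<open>Comparing \<open>B\<close> with itself shows that \<open>atom B v\<close>
    decides every element of \<open>B\<close>. If the atom is zero, the value named here is true,
    which is still correct.\<close>
  have ev: "evaluates P (atom B v) x (bmeet P (atom B v) x = atom B v)" if "is_context P B" "x \<in> B" for B x v
    using agree[OF that(1) that(1) that(2) that(2), of v] by (auto simp: evaluates_def split: if_splits)

  define \<Omega> where "\<Omega> = {v \<in> Pow G. \<exists>i\<in>K. p i v \<noteq> 0}"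
  have fin\<Omega>: "finite \<Omega>" using fin by (simp add: \<Omega>_def)
  \<comment> \<open>The assignment \<open>v\<close> is itself a summand in the weight of its atom,
    so some state is positive there.\<close>
  have atom_nz: "atom B v \<noteq> bzero P" if B: "is_context P B" and v: "v \<in> \<Omega>" for B v
  proof -
    obtain i where i: "i \<in> K" "p i v \<noteq> 0" using v by (auto simp: \<Omega>_def)
    have "p i v \<le> g i (atom B v)"
      unfolding g_atom[OF i(1) B] using v fin p0[OF i(1)] by (intro member_le_sum) (auto simp: \<Omega>_def)
    then have "g i (atom B v) \<noteq> 0" using i p0[OF i(1), of v] by linarith
    then show ?thesis using normalized_measure_bzero[OF ba[OF B] nm[OF B i(1)]] by auto
  qed

  \<comment> \<open>An arbitrary context of \<open>x\<close>; \<open>\<phi>_iff\<close> shows that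
    \<open>\<phi>\<close> does not depend on this choice.\<close>
  define ctx where "ctx x = (SOME B. is_context P B \<and> x \<in> B)" for x
  have ctx: "is_context P (ctx x)" "x \<in> ctx x" if "is_context P B" "x \<in> B" for B x
    using someI[of "\<lambda>B. is_context P B \<and> x \<in> B" B] that by (auto simp: ctx_def)
  define \<phi> where "\<phi> x = {v \<in> \<Omega>. bmeet P (atom (ctx x) v) x = atom (ctx x) v}" for x
  have \<phi>_iff: "v \<in> \<phi> x \<longleftrightarrow> t" if "is_context P B" "x \<in> B" "v \<in> \<Omega>" "evaluates P (atom B v) x t" for B x v t
  proof -
    note B = that(1,2)
    obtain t' where t': "evaluates P (atom B v) x t'" "evaluates P (atom (ctx x) v) x t'"
      using agree[OF B(1) ctx(1)[OF B] B(2) ctx(2)[OF B]] by blast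
    have "v \<in> \<phi> x \<longleftrightarrow> t'"
      using evaluates_iff[OF t'(2) atom_nz] ctx that by (simp add: \<phi>_def)
    also have "t' \<longleftrightarrow> t"
      using evaluates_iff[OF t'(1) atom_nz] evaluates_iff[OF that(4) atom_nz] that by blast
    finally show ?thesis .
  qed
  have \<phi>_ev: "evaluates P (atom B v) x (v \<in> \<phi> x)" if "is_context P B" "x \<in> B" "v \<in> \<Omega>" for B x v
    using ev[OF that(1,2)] \<phi>_iff[OF that ev[OF that(1,2)]] by simp
  have \<phi>_sub: "\<phi> x \<subseteq> \<Omega>" for x by (auto simp: \<phi>_def)
  have ctx_alg: "\<exists>B. is_context P B \<and> C \<subseteq> B" if "C \<in> algs P" for C
    using context_exists[OF P that] by blast
  have ctx_el: "\<exists>B. is_context P B \<and> x \<in> B" if "x \<in> elems P" for x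
    using that ctx_alg unfolding elems_def by blast

  have g_eq: "g i x = sum (p i) (\<phi> x)" if i: "i \<in> K" and x: "x \<in> elems P" for i x
  proof -
    obtain B where B: "is_context P B" "x \<in> B" using ctx_el[OF x] by blast
    let ?S = "G \<inter> B"
    let ?Q = "\<lambda>w. bmeet P (atom B w) x = atom B w"
    have "g i x = (\<Sum>w\<in>{w \<in> Pow (set (en B)). ?Q w}. g i (atom B w))"
      unfolding atom_def using en B ev[OF B, unfolded atom_def]
      by (intro measure_eq_sum_signed_meet[OF ba[OF B(1)] nm[OF B(1) i]]) auto
    \<comment> \<open>Assignments are grouped by their trace on \<open>G \<inter> B\<close>, which
      alone determines whether their atom lies below \<open>x\<close>.\<close>
    also have "\<dots> = (\<Sum>w\<in>{w \<in> Pow ?S. ?Q w}. sum (p i) {v \<in> {v \<in> Pow G. ?Q v}. v \<inter> ?S = w})"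
    proof (rule sum.cong)
      fix w assume w: "w \<in> {w \<in> Pow ?S. ?Q w}"
      have "{v \<in> Pow G. \<forall>a\<in>?S. (a \<in> v) = (a \<in> w)} = {v \<in> Pow G. v \<inter> ?S = w}" using w by auto
      also have "\<dots> = {v \<in> {v \<in> Pow G. ?Q v}. v \<inter> ?S = w}" using w atom_cong[of B] by auto
      finally show "g i (atom B w) = sum (p i) {v \<in> {v \<in> Pow G. ?Q v}. v \<inter> ?S = w}"
        using g_atom[OF i B(1)] by simp
    qed (simp add: en)
    also have "\<dots> = sum (p i) {v \<in> Pow G. ?Q v}"
      using fin atom_cong[of B] by (intro sum.group) auto
    \<comment> \<open>Outside \<open>\<Omega>\<close> all the weights vanish.\<close>
    also have "\<dots> = sum (p i) {v \<in> \<Omega>. ?Q v}"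
      using fin i by (intro sum.mono_neutral_right) (auto simp: \<Omega>_def)
    also have "{v \<in> \<Omega>. ?Q v} = \<phi> x" using \<phi>_iff[OF B _ ev[OF B]] \<phi>_sub by blast
    finally show ?thesis .
  qed

  have hom: "\<phi> (bcompl P x) = \<Omega> - \<phi> x" "\<phi> (bmeet P x y) = \<phi> x \<inter> \<phi> y" "\<phi> (bjoin P x y) = \<phi> x \<union> \<phi> y"
    "\<phi> (bzero P) = {}" "\<phi> (bone P) = \<Omega>"
    if C: "C \<in> algs P" "x \<in> C" "y \<in> C" for C x y
  proof -
    obtain B where B: "is_context P B" "x \<in> B" "y \<in> B" using ctx_alg[OF C(1)] C by blast
    note b = ba[OF B(1)]
    note m = b atom_in[OF B(1)]
    have "v \<in> \<phi> (bcompl P x) \<longleftrightarrow> v \<notin> \<phi> x"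
      "v \<in> \<phi> (bmeet P x y) \<longleftrightarrow> v \<in> \<phi> x \<and> v \<in> \<phi> y"
      "v \<in> \<phi> (bjoin P x y) \<longleftrightarrow> v \<in> \<phi> x \<or> v \<in> \<phi> y"
      "v \<in> \<phi> (bzero P) \<longleftrightarrow> False" "v \<in> \<phi> (bone P) \<longleftrightarrow> True" if v: "v \<in> \<Omega>" for v
    proof -
      note e = \<phi>_ev[OF B(1,2) v] \<phi>_ev[OF B(1,3) v]
      show "v \<in> \<phi> (bcompl P x) \<longleftrightarrow> v \<notin> \<phi> x"
        by (rule \<phi>_iff[OF B(1) bool_alg(3)[OF b B(2)] v evaluates_bcompl[OF m B(2) e(1)]])
      show "v \<in> \<phi> (bmeet P x y) \<longleftrightarrow> v \<in> \<phi> x \<and> v \<in> \<phi> y"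
        by (rule \<phi>_iff[OF B(1) bool_alg(4)[OF b B(2,3)] v evaluates_bmeet[OF m B(2,3) e]])
      show "v \<in> \<phi> (bjoin P x y) \<longleftrightarrow> v \<in> \<phi> x \<or> v \<in> \<phi> y"
        by (rule \<phi>_iff[OF B(1) bool_alg(5)[OF b B(2,3)] v evaluates_bjoin[OF m B(2,3) e]])
      show "v \<in> \<phi> (bzero P) \<longleftrightarrow> False"
        by (rule \<phi>_iff[OF B(1) bool_alg(1)[OF b] v evaluates_bzero[OF m]])
      show "v \<in> \<phi> (bone P) \<longleftrightarrow> True"
        by (rule \<phi>_iff[OF B(1) bool_alg(2)[OF b] v evaluates_bone[OF m]])
    qed
    then show "\<phi> (bcompl P x) = \<Omega> - \<phi> x" "\<phi> (bmeet P x y) = \<phi> x \<inter> \<phi> y"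
      "\<phi> (bjoin P x y) = \<phi> x \<union> \<phi> y" "\<phi> (bzero P) = {}" "\<phi> (bone P) = \<Omega>"
      using \<phi>_sub by blast+
  qed
  obtain B where B: "B \<in> algs P" using P by (auto simp: is_pba_def)
  \<comment> \<open>The unit fills the places of \<open>x\<close> and \<open>y\<close> in the last
    two equations of \<open>hom\<close>, which do not mention them.\<close>
  then have o: "bone P \<in> B" using P by (auto simp: is_pba_def intro: bool_alg(2))
  show ?thesis
  proof (rule admits_classical_representation_setI[OF P fin\<Omega>, where \<phi> = \<phi> and p = "p k"])
    show "inj_on \<phi> (elems P)" using sep g_eq by (metis inj_onI)
    have "g k (bone P) = 1" using st[OF k] B by (simp add: is_state_def normalized_measure_def)
    moreover have "bone P \<in> elems P" using B o by (auto simp: elems_def)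
    ultimately show "sum (p k) \<Omega> = 1" using g_eq[OF k, of "bone P"] hom(5)[OF B o o] by simp
    show "\<phi> (bzero P) = {}" "\<phi> (bone P) = \<Omega>" by (fact hom(4,5)[OF B o o])+
    show "\<phi> (bcompl P x) = \<Omega> - \<phi> x" if "C \<in> algs P" "x \<in> C" for C x
      by (rule hom(1)[OF that that(2)])
  qed (rule \<phi>_sub hom(2,3) g_eq[OF k] p0[OF k]; assumption)+
qed

text \<open>For a context \<open>B\<close> the set \<open>G \<inter> B\<close> is maximal
  compatible, so \<open>free_HT_state\<close> carries the values of \<open>g\<close> on its free
  atoms over to the values of \<open>g'\<close> on signed meets in \<open>P\<close>.\<close>

lemma free_HT_representation_weights:
  assumes P: "is_pba P" and G: "generates_pba P G" and ht: "free_HT_state P G g' g"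
    and adm: "admits_classical_representation (free_HT_pba P G) g"
  obtains p :: "'a set \<Rightarrow> real" where "\<And>v. 0 \<le> p v"
    "\<And>B xs \<epsilon>. is_context P B \<Longrightarrow> distinct xs \<Longrightarrow> set xs = G \<inter> B \<Longrightarrow>
       g' (signed_meet P \<epsilon> (\<lambda>a. a) xs) = sum p {v \<in> Pow G. \<forall>a\<in>set xs. (a \<in> v) = \<epsilon> a}"
proof -
  let ?F = "\<lambda>S. generated (free_ops G) (free_gen G ` S)"
  have GP: "G \<subseteq> elems P" using G by (simp add: generates_pba_def)
  have fin: "finite G" using P GP by (meson is_pba_def finite_subset)
  \<comment> \<open>A single generator is compatible, so the algebra freely generated by it is a
    member of the free theory.\<close>
  have "free_gen G a \<in> elems (free_HT_pba P G)" if "a \<in> G" for a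
  proof -
    have "?F {a} \<in> algs (free_HT_pba P G)"
      using that GP compatible_singleton[OF P, of a] by (intro generated_free_in_algs) auto
    moreover have "free_gen G a \<in> ?F {a}" by (auto intro: generated.base)
    ultimately show ?thesis unfolding elems_def by blast
  qed
  then have "free_gen G ` G \<subseteq> elems (free_HT_pba P G)" by blast
  from classical_representation_weights[OF free_HT_pba_is_pba[OF P GP] adm fin this]
  obtain p :: "'a set \<Rightarrow> real" where p: "\<And>v. 0 \<le> p v"
    "\<And>C xs \<epsilon>. C \<in> algs (free_HT_pba P G) \<Longrightarrow> set xs \<subseteq> G \<Longrightarrow> free_gen G ` set xs \<subseteq> C \<Longrightarrow>
       g (signed_meet (free_HT_pba P G) \<epsilon> (free_gen G) xs) =
       sum p {v \<in> Pow G. \<forall>a\<in>set xs. (a \<in> v) = \<epsilon> a}"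
    by blast
  show thesis
  proof
    fix B xs \<epsilon>
    assume B: "is_context P B" and xs: "distinct xs" "set xs = G \<inter> B"
    note S = context_generators(2)[OF P G B]
    have "g' (signed_meet P \<epsilon> (\<lambda>a. a) xs) = g (signed_meet (free_ops G) \<epsilon> (free_gen G) xs)"
      using ht S xs by (simp add: free_HT_state_def)
    also have "\<dots> = sum p {v \<in> Pow G. \<forall>a\<in>set xs. (a \<in> v) = \<epsilon> a}"
      unfolding signed_meet_free_HT_pba[of P, symmetric]
    proof (rule p(2)[of "?F (G \<inter> B)"])
      show "?F (G \<inter> B) \<in> algs (free_HT_pba P G)"
        using S by (intro generated_free_in_algs) (auto simp: maximal_compatible_def)
    qed (use xs in \<open>auto intro: generated.base\<close>)
    finally show "g' (signed_meet P \<epsilon> (\<lambda>a. a) xs) =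
      sum p {v \<in> Pow G. \<forall>a\<in>set xs. (a \<in> v) = \<epsilon> a}" .
  qed (fact p(1))
qed

section \<open>Both implications for the whole collection of states\<close>

theorem mainTheorem1:
  fixes P :: "'a pba"
    and K :: "'k set"
    and f' :: "'k \<Rightarrow> 'a \<Rightarrow> real"
    and G :: "'a set"
    and f :: "'k \<Rightarrow> 'a set set \<Rightarrow> real"
  assumes "is_pba P"
    and "\<forall>k\<in>K. is_ppt P (f' k)"
    and "complete_states P K f'"
    and "generates_pba P G"
    and "property_G P G"
    and "\<forall>k\<in>K. free_HT_state P G (f' k) (f k)"
  shows "(\<forall>k\<in>K. admits_classical_representation P (f' k) \<longrightarrow>
                 admits_classical_representation (free_HT_pba P G) (f k)) \<and>
         (\<forall>K'\<subseteq>K. separating_states P K' f' \<and>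
                  (\<forall>k\<in>K'. admits_classical_representation (free_HT_pba P G) (f k)) \<longrightarrow>
                  (\<forall>k\<in>K'. admits_classical_representation P (f' k)))"
proof (intro conjI ballI allI impI)
  have G: "G \<subseteq> elems P" using assms(4) by (simp add: generates_pba_def)
  show "admits_classical_representation (free_HT_pba P G) (f k)"
    if "k \<in> K" "admits_classical_representation P (f' k)" for k
    using that G assms(2,6) by (intro free_HT_admits_classical_representation) auto
  fix K' k
  assume "K' \<subseteq> K" and K': "separating_states P K' f' \<and>
    (\<forall>k\<in>K'. admits_classical_representation (free_HT_pba P G) (f k))" and k: "k \<in> K'"
  then have ht: "free_HT_state P G (f' i) (f i)" and st: "is_state P (f' i)" if "i \<in> K'" for i
    using assms(2,6) that by (auto simp: is_ppt_def)
  \<comment> \<open>Weights are gathered for all of \<open>K'\<close>, even though only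
    \<open>k\<close> is to be represented: separation, and with it injectivity of the embedding,
    needs every state.\<close>
  have "\<forall>i\<in>K'. \<exists>p. (\<forall>v. 0 \<le> p v) \<and> (\<forall>B xs \<epsilon>. is_context P B \<longrightarrow> distinct xs \<longrightarrow> set xs = G \<inter> B \<longrightarrow>
      f' i (signed_meet P \<epsilon> (\<lambda>a. a) xs) = sum p {v \<in> Pow G. \<forall>a\<in>set xs. (a \<in> v) = \<epsilon> a})"
  proof
    fix i assume i: "i \<in> K'"
    with K' have "admits_classical_representation (free_HT_pba P G) (f i)" by blast
    from free_HT_representation_weights[OF assms(1,4) ht[OF i] this]
    obtain p :: "'a set \<Rightarrow> real" where "\<And>v. 0 \<le> p v"
      "\<And>B xs \<epsilon>. is_context P B \<Longrightarrow> distinct xs \<Longrightarrow> set xs = G \<inter> B \<Longrightarrow>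
        f' i (signed_meet P \<epsilon> (\<lambda>a. a) xs) = sum p {v \<in> Pow G. \<forall>a\<in>set xs. (a \<in> v) = \<epsilon> a}"
      by blast
    then show "\<exists>p. (\<forall>v. 0 \<le> p v) \<and> (\<forall>B xs \<epsilon>. is_context P B \<longrightarrow> distinct xs \<longrightarrow> set xs = G \<inter> B \<longrightarrow>
      f' i (signed_meet P \<epsilon> (\<lambda>a. a) xs) = sum p {v \<in> Pow G. \<forall>a\<in>set xs. (a \<in> v) = \<epsilon> a})"
      by blast
  qed
  from bchoice[OF this] obtain p where p: "\<And>i v. i \<in> K' \<Longrightarrow> 0 \<le> p i v"
    "\<And>i B xs \<epsilon>. i \<in> K' \<Longrightarrow> is_context P B \<Longrightarrow> distinct xs \<Longrightarrow> set xs = G \<inter> B \<Longrightarrow>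
      f' i (signed_meet P \<epsilon> (\<lambda>a. a) xs) = sum (p i) {v \<in> Pow G. \<forall>a\<in>set xs. (a \<in> v) = \<epsilon> a}"
    by blast
  show "admits_classical_representation P (f' k)"
  proof (rule admits_classical_representation_of_weights[OF assms(1) st assms(4,5) _ p k])
    show "\<exists>k\<in>K'. f' k x \<noteq> f' k y" if "x \<in> elems P" "y \<in> elems P" "x \<noteq> y" for x y
      using K' that by (simp add: separating_states_def)
  qed
qed

end
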